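(* Let $\mathcal A=\{H_1,\dots,H_n\}$ be an essential hyperplane arrangement in $V=\mathbb C^r$, and let $h_1,\dots,h_m$ be the lines in the arrangement. The multigraded Hilbert series of the zonotopal Cox ring $\mathcal Z(\mathcal A)$ is given by $$\mathrm{Hilb}(\mathcal Z(\mathcal A);t,s_1,\dots,s_m)=\frac{1}{\prod_{i=1}^n(1-S_it)}\;\widetilde Z_{\mathcal A}\!\left(1-t;\frac{S_1(1-t)}{1-S_1},\dots,\frac{S_n(1-t)}{1-S_n}\right),$$ where $S_j=\prod_{i:\,h_i\not\subset H_j}s_i$ for $1\le j\le n$.
   Context: $\mathcal A$ is a finite list of hyperplanes $H_j=\{l_j=0\}$ through the origin, $0\ne l_j\in V^*$; essential means the $l_j$ span $V^*$. The lines of $\mathcal A$ are its one-dimensional intersections of hyperplanes (with $V$ itself regarded as the empty intersection); for each line choose a nonzero vector, also denoted $h_i$. Let $G=\{\lambda\in\mathbb C^m:\sum_i\lambda_ih_i=0\}$, an additive group acting on $R=\mathbb C[s_1,\dots,s_m,t_1,\dots,t_m]$ by $s_i\mapsto s_i$, $t_i\mapsto t_i+\lambda_is_i$. The invariant ring $R^G$ is $\mathbb Z^{m+1}$-graded by $\deg s_i=e_i$, $\deg t_i=e_0+e_i$, where $e_0,\dots,e_m$ is the standard basis; $R^G_{(d,\mathbf u)}$ is the component of degree $d e_0+\sum_i u_ie_i$. Let $H$ be the $m\times n$ matrix with $(i,j)$ entry $0$ if $h_i\subset H_j$ and $1$ otherwise. The zonotopal Cox ring is $\mathcal Z(\mathcal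 A)=\bigoplus_{(d,\mathbf a)\in\mathbb N\times\mathbb N^n}R^G_{(d,H\mathbf a)}$, and its multigraded Hilbert series is $\sum_{(d,\mathbf a)}\dim R^G_{(d,H\mathbf a)}\,t^d\prod_{i=1}^m s_i^{(H\mathbf a)_i}$. The multivariate Tutte polynomial is $\widetilde Z_{\mathcal A}(q;v_1,\dots,v_n)=\sum_{\mathcal B\subseteq[n]}q^{-r(\mathcal B)}\prod_{e\in\mathcal B}v_e$, where $r(\mathcal B)=\dim\mathrm{span}\{l_e:e\in\mathcal B\}$. *)

theory Defs
  imports "HOL-Analysis.Analysis" "HOL-Library.Poly_Mapping"
begin

section \<open>Formal power series in several variables\<close>

text \<open>
  A series is an arbitrary coefficient function on the exponents of finite support.
\<close>

typedef ('v, 'a) mfps = "UNIV :: (('v \<Rightarrow>\<^sub>0 nat) \<Rightarrow> 'a) set"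
  morphisms mfps_nth Abs_mfps
  by simp

lemma mfps_nth_Abs [simp]: "mfps_nth (Abs_mfps f) = f"
  by (simp add: Abs_mfps_inverse)

lemma mfps_eqI: "(\<And>w. mfps_nth f w = mfps_nth g w) \<Longrightarrow> f = g"
  by (metis mfps_nth_inject ext)

lemma finite_exponents_le:
  "finite {i :: 'v \<Rightarrow>\<^sub>0 nat. \<forall>x. Poly_Mapping.lookup i x \<le> Poly_Mapping.lookup k x}"
    (is "finite ?D")
proof -
  let ?K = "Poly_Mapping.keys k" and ?N = "\<Sum>x\<in>Poly_Mapping.keys k. Poly_Mapping.lookup k x"
  let ?F = "{f. \<forall>x. (x \<in> ?K \<longrightarrow> f x \<in> {..?N}) \<and> (x \<notin> ?K \<longrightarrow> f x = 0)}"
  have "Poly_Mapping.lookup ` ?D \<subseteq> ?F"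
  proof clarify
    fix i :: "'v \<Rightarrow>\<^sub>0 nat" and x
    assume le: "\<forall>x. Poly_Mapping.lookup i x \<le> Poly_Mapping.lookup k x"
    have "Poly_Mapping.lookup i x \<le> ?N" if "x \<in> ?K"
      using le member_le_sum[of x ?K "Poly_Mapping.lookup k"] that by (metis finite_keys le_trans zero_le)
    moreover have "Poly_Mapping.lookup i x = 0" if "x \<notin> ?K"
      using le that by (metis in_keys_iff le_zero_eq)
    ultimately show "(x \<in> ?K \<longrightarrow> Poly_Mapping.lookup i x \<in> {..?N}) \<and>
        (x \<notin> ?K \<longrightarrow> Poly_Mapping.lookup i x = 0)" by simp
  qed
  moreover have "finite ?F"
    by (rule finite_set_of_finite_funs) auto
  moreover have "inj_on Poly_Mapping.lookup ?D"
    by (simp add: inj_on_def)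
  ultimately show ?thesis
    using finite_subset finite_imageD by meson
qed

lemma finite_antidiagonal [simp]: "finite {(i, j). i + j = (k :: 'v \<Rightarrow>\<^sub>0 nat)}"
proof (rule finite_subset)
  let ?D = "{i. \<forall>x. Poly_Mapping.lookup i x \<le> Poly_Mapping.lookup k x}"
  show "{(i, j). i + j = k} \<subseteq> ?D \<times> ?D"
    by (auto simp: lookup_add)
  show "finite (?D \<times> ?D)"
    by (intro finite_cartesian_product finite_exponents_le)
qed

instantiation mfps :: (type, comm_ring_1) comm_ring_1
begin

definition "0 = Abs_mfps (\<lambda>w. 0)"
definition "1 = Abs_mfps (\<lambda>w. if w = 0 then 1 else 0)"
definition "f + g = Abs_mfps (\<lambda>w. mfps_nth f w + mfps_nth g w)"
definition "f - g = Abs_mfps (\<lambda>w. mfps_nth f w - mfps_nth g w)"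
definition "- f = Abs_mfps (\<lambda>w. - mfps_nth f w)"
definition "f * g = Abs_mfps (\<lambda>w. \<Sum>(i, j) | i + j = w. mfps_nth f i * mfps_nth g j)"

instance
proof
  fix f g h :: "('a, 'b) mfps"
  show "f + g + h = f + (g + h)" "f + g = g + f" "0 + f = f" "- f + f = 0" "f - g = f + - g"
    by (simp_all add: plus_mfps_def zero_mfps_def uminus_mfps_def minus_mfps_def ac_simps
        mfps_nth_inverse)
  show "f * g * h = f * (g * h)"
  proof (rule mfps_eqI)
    fix w
    have "mfps_nth (f * g * h) w =
        (\<Sum>(p, c) | p + c = w. \<Sum>(a, b) | a + b = p. mfps_nth f a * mfps_nth g b * mfps_nth h c)"
      by (simp add: times_mfps_def sum_distrib_right case_prod_beta)
    also have "\<dots> = (\<Sum>((p, c), (a, b)) \<in> Sigma {(p, c). p + c = w} (\<lambda>x. {(a, b). a + b = fst x}).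
        mfps_nth f a * mfps_nth g b * mfps_nth h c)"
      by (simp add: case_prod_beta sum.Sigma)
    also have "\<dots> = (\<Sum>((a, p), (b, c)) \<in> Sigma {(a, p). a + p = w} (\<lambda>x. {(b, c). b + c = snd x}).
        mfps_nth f a * mfps_nth g b * mfps_nth h c)"
      by (rule sum.reindex_bij_witness[where
            i = "\<lambda>((a, p), (b, c)). ((a + b, c), (a, b))" and
            j = "\<lambda>((p, c), (a, b)). ((a, b + c), (b, c))"]) (auto simp: add.assoc)
    also have "\<dots> = (\<Sum>(a, p) | a + p = w. \<Sum>(b, c) | b + c = p.
        mfps_nth f a * mfps_nth g b * mfps_nth h c)"
      by (simp add: case_prod_beta sum.Sigma)
    also have "\<dots> = mfps_nth (f * (g * h)) w"
      by (simp add: times_mfps_def sum_distrib_left case_prod_beta mult.assoc)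
    finally show "mfps_nth (f * g * h) w = mfps_nth (f * (g * h)) w" .
  qed
  show "f * g = g * f"
  proof (rule mfps_eqI)
    fix w
    show "mfps_nth (f * g) w = mfps_nth (g * f) w"
      unfolding times_mfps_def mfps_nth_Abs
      by (rule sum.reindex_bij_witness[where i = prod.swap and j = prod.swap])
        (auto simp: add.commute mult.commute)
  qed
  show "1 * f = f"
  proof (rule mfps_eqI)
    fix w
    have "mfps_nth (1 * f) w = (\<Sum>(i, j) \<in> {(0, w)}. mfps_nth 1 i * mfps_nth f j)"
      unfolding times_mfps_def mfps_nth_Abs
      by (rule sum.mono_neutral_right) (auto simp: one_mfps_def split: if_splits)
    then show "mfps_nth (1 * f) w = mfps_nth f w"
      by (simp add: one_mfps_def)
  qed
  show "(f + g) * h = f * h + g * h"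
    by (simp add: plus_mfps_def times_mfps_def distrib_right case_prod_beta sum.distrib)
  have "mfps_nth (0 :: ('a, 'b) mfps) 0 \<noteq> mfps_nth 1 0"
    by (simp add: zero_mfps_def one_mfps_def)
  then show "(0 :: ('a, 'b) mfps) \<noteq> 1"
    by metis
qed

end

text \<open>
  The multiplicative inverse of a unit, and \<open>0\<close> for a non-unit.
\<close>

instantiation mfps :: (type, comm_ring_1) inverse
begin

definition "inverse f = (if f dvd 1 then THE g. f * g = 1 else (0 :: ('a, 'b) mfps))"
definition "f div g = f * inverse (g :: ('a, 'b) mfps)"

instance ..

end

lemma mfps_inverse_unique:
  fixes f g :: "('v, 'a::comm_ring_1) mfps"
  assumes "f * g = 1"
  shows "inverse f = g"
proof -
  have "h = g" if "f * h = 1" for h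
  proof -
    have "h = (f * g) * h"
      by (simp add: assms)
    also have "\<dots> = (f * h) * g"
      by (simp add: mult_ac)
    finally show ?thesis
      by (simp add: that)
  qed
  then have "(THE g. f * g = 1) = g"
    using assms by (intro the_equality)
  moreover have "f dvd 1"
    using assms[symmetric] by (rule dvdI)
  ultimately show ?thesis
    by (simp add: inverse_mfps_def)
qed

lemma mfps_is_unit:
  fixes f :: "('v, 'a::comm_ring_1) mfps"
  assumes "mfps_nth f 0 = 1"
  shows "f * inverse f = 1"
proof -
  define deg where "deg w = (\<Sum>x\<in>Poly_Mapping.keys w. Poly_Mapping.lookup w x)" for w :: "'v \<Rightarrow>\<^sub>0 nat"
  have deg_alt: "deg w = (\<Sum>x\<in>K. Poly_Mapping.lookup w x)"
    if "finite K" "Poly_Mapping.keys w \<subseteq> K" for K w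
    unfolding deg_def using that by (intro sum.mono_neutral_left) (auto simp: in_keys_iff)
  have deg_add: "deg (i + j) = deg i + deg j" for i j
  proof -
    let ?K = "Poly_Mapping.keys i \<union> Poly_Mapping.keys j"
    have "deg (i + j) = (\<Sum>x\<in>?K. Poly_Mapping.lookup (i + j) x)"
      by (intro deg_alt Poly_Mapping.keys_add) auto
    also have "\<dots> = deg i + deg j"
      by (simp add: lookup_add sum.distrib deg_alt[of ?K])
    finally show ?thesis .
  qed
  have deg_pos: "deg i > 0" if "i \<noteq> 0" for i
    using that by (auto simp: deg_def in_keys_iff intro!: sum_pos)
  define g where "g = 1 - f"
  have g0: "mfps_nth g 0 = 0"
    by (simp add: g_def minus_mfps_def one_mfps_def assms)
  have small: "mfps_nth (g ^ k) w = 0" if "deg w < k" for k w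
    using that
  proof (induction k arbitrary: w)
    case 0
    then show ?case by simp
  next
    case (Suc k)
    have "mfps_nth g i * mfps_nth (g ^ k) j = 0" if "i + j = w" for i j
    proof (cases "i = 0")
      case True
      then show ?thesis by (simp add: g0)
    next
      case False
      with Suc.prems that deg_pos[of i] deg_add[of i j] have "deg j < k" by simp
      then show ?thesis by (simp add: Suc.IH)
    qed
    then have "mfps_nth (g * g ^ k) w = 0"
      unfolding times_mfps_def[of g "g ^ k"] mfps_nth_Abs by (intro sum.neutral) auto
    then show ?case by simp
  qed
  have nth_sum: "mfps_nth (sum F A) w = (\<Sum>k\<in>A. mfps_nth (F k) w)" if "finite A"
    for F :: "nat \<Rightarrow> ('v, 'a) mfps" and A w
    using that by induction (simp_all add: zero_mfps_def plus_mfps_def)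
  define G where "G = Abs_mfps (\<lambda>w. \<Sum>k\<le>deg w. mfps_nth (g ^ k) w)"
  have "f * G = 1"
  proof (rule mfps_eqI)
    fix w
    let ?P = "\<Sum>k\<le>deg w. g ^ k"
    have G_eq: "mfps_nth G j = mfps_nth ?P j" if "deg j \<le> deg w" for j
      unfolding G_def mfps_nth_Abs nth_sum[OF finite_atMost]
      using that by (intro sum.mono_neutral_left) (auto intro: small)
    have "mfps_nth (f * G) w = mfps_nth (f * ?P) w"
      unfolding times_mfps_def[of f] mfps_nth_Abs
      by (intro sum.cong) (auto simp: G_eq deg_add)
    also have "f * ?P = 1 - g ^ Suc (deg w)"
    proof -
      have "f * ?P = (1 - g) * ?P" by (simp add: g_def)
      also have "\<dots> = 1 - g ^ Suc (deg w)"
        using one_diff_power_eq[of g "Suc (deg w)"] by (simp add: lessThan_Suc_atMost)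
      finally show ?thesis .
    qed
    also have "mfps_nth \<dots> w = mfps_nth 1 w"
      using small[of w "Suc (deg w)"] by (simp add: minus_mfps_def)
    finally show "mfps_nth (f * G) w = mfps_nth 1 w" .
  qed
  then show ?thesis
    using mfps_inverse_unique by blast
qed

definition mfps_X :: "'v \<Rightarrow> ('v, 'a::comm_ring_1) mfps"
  where "mfps_X v = Abs_mfps (\<lambda>w. if w = Poly_Mapping.single v 1 then 1 else 0)"

lemma mfps_nth_mult_monom:
  "mfps_nth (f * Abs_mfps (\<lambda>w. if w = v then 1 else 0)) w \<noteq> 0 \<Longrightarrow>
    \<exists>u. w = u + v \<and> mfps_nth f u \<noteq> 0"
proof (rule ccontr)
  assume nz: "mfps_nth (f * Abs_mfps (\<lambda>w. if w = v then 1 else 0)) w \<noteq> 0"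
    and no: "\<nexists>u. w = u + v \<and> mfps_nth f u \<noteq> 0"
  have "mfps_nth (f * Abs_mfps (\<lambda>w. if w = v then 1 else 0)) w = 0"
    unfolding times_mfps_def mfps_nth_Abs using no by (intro sum.neutral) auto
  with nz show False by contradiction
qed

lemma mfps_X_power_prod_supp:
  fixes f :: "('v, 'a::comm_ring_1) mfps"
  assumes "mfps_nth (f * mfps_X x ^ n) w \<noteq> 0"
  shows "\<exists>u. w = u + Poly_Mapping.single x n \<and> mfps_nth f u \<noteq> 0"
  using assms
proof (induction n arbitrary: w)
  case 0
  then show ?case by auto
next
  case (Suc n)
  from Suc.prems have "mfps_nth ((f * mfps_X x ^ n) * mfps_X x) w \<noteq> 0"
    by (simp add: mult_ac)
  from mfps_nth_mult_monom[OF this[unfolded mfps_X_def]]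
  obtain u where u: "w = u + Poly_Mapping.single x 1" "mfps_nth (f * mfps_X x ^ n) u \<noteq> 0"
    by (auto simp: mfps_X_def)
  from Suc.IH[OF u(2)] obtain v where
    "u = v + Poly_Mapping.single x n" "mfps_nth f v \<noteq> 0" by blast
  with u(1) show ?case
    by (intro exI[of _ v]) (simp add: add.assoc flip: single_add)
qed

text \<open>
  The sum of a family of series, coefficient by coefficient. It is meaningful for families
  in which every exponent has a nonzero coefficient in only finitely many members.
\<close>

definition mfps_Sum :: "('i \<Rightarrow> ('v, 'a::comm_ring_1) mfps) \<Rightarrow> ('v, 'a) mfps"
  where "mfps_Sum f = Abs_mfps (\<lambda>w. Sum_any (\<lambda>x. mfps_nth (f x) w))"


section \<open>Polynomials over the complex numbers\<close>

type_synonym 'v cpoly = "('v \<Rightarrow>\<^sub>0 nat) \<Rightarrow>\<^sub>0 complex"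

definition cpoly_const :: "complex \<Rightarrow> 'v cpoly"
  where "cpoly_const c = Poly_Mapping.single 0 c"

definition cpoly_var :: "'v \<Rightarrow> 'v cpoly"
  where "cpoly_var x = Poly_Mapping.single (Poly_Mapping.single x 1) 1"

definition cpoly_subst :: "('v \<Rightarrow> 'w cpoly) \<Rightarrow> 'v cpoly \<Rightarrow> 'w cpoly"
  where "cpoly_subst f p = (\<Sum>w\<in>Poly_Mapping.keys p. cpoly_const (Poly_Mapping.lookup p w) *
    (\<Prod>x\<in>Poly_Mapping.keys w. f x ^ Poly_Mapping.lookup w x))"

definition cpoly_scale :: "complex \<Rightarrow> 'v cpoly \<Rightarrow> 'v cpoly"
  where "cpoly_scale c p = cpoly_const c * p"

global_interpretation cpoly: vector_space cpoly_scale
proof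
  fix a b :: complex and p q :: "'a cpoly"
  show "cpoly_scale a (p + q) = cpoly_scale a p + cpoly_scale a q"
    by (simp add: cpoly_scale_def distrib_left)
  show "cpoly_scale (a + b) p = cpoly_scale a p + cpoly_scale b p"
    by (simp add: cpoly_scale_def cpoly_const_def single_add distrib_right)
  show "cpoly_scale a (cpoly_scale b p) = cpoly_scale (a * b) p"
    by (simp add: cpoly_scale_def cpoly_const_def mult_single flip: mult.assoc)
  show "cpoly_scale 1 p = p"
    by (simp add: cpoly_scale_def cpoly_const_def)
qed


section \<open>Arrangements and their lines\<close>

text \<open>
  The linear form with coefficient vector \<open>l\<close> is \<open>x \<mapsto> \<Sum>k. l $ k * x $ k\<close>; this identifies the
  dual space of \<^typ>\<open>complex ^ 'r\<close> with \<^typ>\<open>complex ^ 'r\<close> itself. An arrangement is the family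
  \<open>l\<close> of the coefficient vectors of its forms, indexed by a finite type, so that hyperplanes
  may be repeated.
\<close>

definition hyperplane_of :: "complex ^ 'r \<Rightarrow> (complex ^ 'r) set"
  where "hyperplane_of l = {x. (\<Sum>k\<in>UNIV. l $ k * x $ k) = 0}"

definition arrangement :: "('n::finite \<Rightarrow> complex ^ 'r) \<Rightarrow> bool"
  where "arrangement l \<longleftrightarrow> (\<forall>j. l j \<noteq> 0)"

definition essential :: "('n::finite \<Rightarrow> complex ^ 'r) \<Rightarrow> bool"
  where "essential l \<longleftrightarrow> vec.span (l ` UNIV) = UNIV"

definition arr_lines :: "('n::finite \<Rightarrow> complex ^ 'r) \<Rightarrow> (complex ^ 'r) set set"
  where "arr_lines l = {K. (\<exists>J. K = (\<Inter>j\<in>J. hyperplane_of (l j))) \<and> vec.dim K = 1}"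

lemma line_not_subset_hyperplane:
  fixes l :: "'n::finite \<Rightarrow> complex ^ 'r"
  assumes "essential l" and "l j \<noteq> 0"
  shows "\<exists>K\<in>arr_lines l. \<not> K \<subseteq> hyperplane_of (l j)"
proof -
  define e where "e v x = (\<Sum>k\<in>UNIV. v $ k * x $ k)" for v x :: "complex ^ 'r"
  have e_diff: "e v (x - c *s y) = e v x - c * e v y" for v x y c
    by (simp add: e_def algebra_simps sum_subtractf sum_distrib_left)
  have mem: "x \<in> hyperplane_of v \<longleftrightarrow> e v x = 0" for v x
    by (simp add: hyperplane_of_def e_def)
  define W where "W J = (\<Inter>i\<in>J. hyperplane_of (l i))" for J
  have memW: "x \<in> W J \<longleftrightarrow> (\<forall>i\<in>J. e (l i) x = 0)" for x J
    by (simp add: W_def mem)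
  obtain k where k: "l j $ k \<noteq> 0"
    using assms(2) by (metis vec_eq_iff zero_index)
  have "e (l j) (axis k 1) = l j $ k"
    by (simp add: e_def axis_def if_distrib cong: if_cong)
  then have "\<not> W {} \<subseteq> hyperplane_of (l j)"
    using k by (simp add: W_def mem subset_eq) metis
  then obtain J where J: "\<not> W J \<subseteq> hyperplane_of (l j)"
    and max: "\<And>J'. \<not> W J' \<subseteq> hyperplane_of (l j) \<Longrightarrow> J \<subseteq> J' \<Longrightarrow> J' = J"
    using finite_has_maximal[of "{J. \<not> W J \<subseteq> hyperplane_of (l j)}"]
    by (simp del: not_all) (metis (no_types, lifting))
  obtain x where x: "x \<in> W J" "e (l j) x \<noteq> 0"
    using J mem by blast
  have nondeg: "z = 0" if "\<And>i. e (l i) z = 0" for z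
  proof -
    have "e v z = 0" if "v \<in> vec.span (l ` UNIV)" for v
      using that
    proof (induction rule: vec.span_induct_alt)
      case base
      show ?case by (simp add: e_def)
    next
      case (step c v w)
      have "e (c *s v + w) z = c * e v z + e w z"
        by (simp add: e_def algebra_simps sum.distrib sum_distrib_left)
      with step \<open>\<And>i. e (l i) z = 0\<close> show ?case by auto
    qed
    then have "e (axis i 1) z = 0" for i
      using assms(1) by (simp add: essential_def)
    moreover have "e (axis i 1) z = z $ i" for i
      by (simp add: e_def axis_def if_distrib[of "\<lambda>u. u * _"] cong: if_cong)
    ultimately show ?thesis
      by (simp add: vec_eq_iff)
  qed
  have "y \<in> vec.span {x}" if y: "y \<in> W J" for y
  proof -
    define z where "z = y - (e (l j) y / e (l j) x) *s x"
    have zW: "z \<in> W J" and zj: "e (l j) z = 0"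
      using x y by (auto simp: z_def e_diff memW)
    have "z = 0"
    proof (rule ccontr)
      assume "z \<noteq> 0"
      then obtain i where i: "e (l i) z \<noteq> 0"
        using nondeg by blast
      define y' where "y' = x - (e (l i) x / e (l i) z) *s z"
      have "y' \<in> W (insert i J)" "e (l j) y' \<noteq> 0"
        using x zW zj i by (auto simp: y'_def e_diff memW)
      then have "insert i J = J"
        by (intro max) (auto simp: mem)
      with zW i show False by (auto simp: memW)
    qed
    then have "y = (e (l j) y / e (l j) x) *s x"
      by (simp add: z_def)
    then show ?thesis
      by (metis vec.span_base vec.span_scale singletonI)
  qed
  moreover have "c *s x \<in> W J" for c
    using x(1) by (auto simp: memW e_def mult.left_commute simp flip: sum_distrib_left)
  ultimately have "W J = vec.span {x}"
    by (auto simp: vec.span_singleton)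
  moreover have "x \<noteq> 0"
    using x(2) by (auto simp: e_def)
  ultimately have "vec.dim (W J) = 1"
    by (simp add: vec.dim_eq_card_independent)
  then have "W J \<in> arr_lines l"
    by (auto simp: arr_lines_def W_def)
  with J show ?thesis by blast
qed

definition incidence_matrix ::
    "('n::finite \<Rightarrow> complex ^ 'r) \<Rightarrow> ('m::finite \<Rightarrow> (complex ^ 'r) set) \<Rightarrow> nat ^ 'n ^ 'm"
  where "incidence_matrix l L = (\<chi> i j. if L i \<subseteq> hyperplane_of (l j) then 0 else 1)"

definition tutte_mv ::
    "('n::finite \<Rightarrow> complex ^ 'r) \<Rightarrow> 'a::{comm_ring_1, inverse} \<Rightarrow> ('n \<Rightarrow> 'a) \<Rightarrow> 'a"
  where "tutte_mv l q v =
    (\<Sum>B\<in>UNIV. inverse q ^ vec.dim (vec.span (l ` B)) * (\<Prod>e\<in>B. v e))"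


section \<open>The invariant ring and the zonotopal Cox ring\<close>

datatype 'm rvar = SVar 'm | TVar 'm

definition relations_group :: "('m::finite \<Rightarrow> complex ^ 'r) \<Rightarrow> (complex ^ 'm) set"
  where "relations_group h = {c. (\<Sum>i\<in>UNIV. c $ i *s h i) = 0}"

definition shift_action :: "complex ^ 'm \<Rightarrow> 'm rvar cpoly \<Rightarrow> 'm rvar cpoly"
  where "shift_action c = cpoly_subst (\<lambda>x. case x of
      SVar i \<Rightarrow> cpoly_var (SVar i)
    | TVar i \<Rightarrow> cpoly_var (TVar i) + cpoly_const (c $ i) * cpoly_var (SVar i))"

definition invariant_ring :: "('m::finite \<Rightarrow> complex ^ 'r) \<Rightarrow> 'm rvar cpoly set"
  where "invariant_ring h = {p. \<forall>c\<in>relations_group h. shift_action c p = p}"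

text \<open>
  Degrees are indexed by \<^typ>\<open>'m option\<close>: \<open>None\<close> stands for \<open>e\<^sub>0\<close> and \<open>Some i\<close> for \<open>e\<^sub>i\<close>.
  Only nonnegative degrees occur.
\<close>

fun var_degree :: "'m rvar \<Rightarrow> 'm option \<Rightarrow> nat" where
  "var_degree (SVar i) k = of_bool (k = Some i)"
| "var_degree (TVar i) k = of_bool (k = None) + of_bool (k = Some i)"

definition monom_degree :: "('m rvar \<Rightarrow>\<^sub>0 nat) \<Rightarrow> 'm option \<Rightarrow> nat"
  where "monom_degree w k =
    (\<Sum>x\<in>Poly_Mapping.keys w. Poly_Mapping.lookup w x * var_degree x k)"

definition invariant_component ::
    "('m::finite \<Rightarrow> complex ^ 'r) \<Rightarrow> nat \<Rightarrow> nat ^ 'm \<Rightarrow> 'm rvar cpoly set"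
  where "invariant_component h d u = {p \<in> invariant_ring h.
    \<forall>w\<in>Poly_Mapping.keys p. monom_degree w = case_option d (($) u)}"

text \<open>
  The zonotopal Cox ring is the external direct sum of the following components over all
  \<open>(d, a)\<close>; different \<open>a\<close> contribute separately even if they have the same image under the
  incidence matrix.
\<close>

definition zonotopal_cox_component ::
    "('n::finite \<Rightarrow> complex ^ 'r) \<Rightarrow> ('m::finite \<Rightarrow> (complex ^ 'r) set) \<Rightarrow> ('m \<Rightarrow> complex ^ 'r) \<Rightarrow>
      nat \<Rightarrow> nat ^ 'n \<Rightarrow> 'm rvar cpoly set"
  where "zonotopal_cox_component l L h d a = invariant_component h d (incidence_matrix l L *v a)"

text \<open>
  The variable \<open>None\<close> of the Hilbert series is \<open>t\<close>, and \<open>Some i\<close> is \<open>s\<^sub>i\<close>.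
\<close>

abbreviation hilb_t :: "('m option, int) mfps"
  where "hilb_t \<equiv> mfps_X None"

abbreviation hilb_s :: "'m \<Rightarrow> ('m option, int) mfps"
  where "hilb_s i \<equiv> mfps_X (Some i)"

definition zonotopal_cox_hilb ::
    "('n::finite \<Rightarrow> complex ^ 'r) \<Rightarrow> ('m::finite \<Rightarrow> (complex ^ 'r) set) \<Rightarrow> ('m \<Rightarrow> complex ^ 'r) \<Rightarrow>
      ('m option, int) mfps"
  where "zonotopal_cox_hilb l L h = mfps_Sum (\<lambda>(d, a).
    of_nat (cpoly.dim (zonotopal_cox_component l L h d a)) * hilb_t ^ d *
    (\<Prod>i\<in>UNIV. hilb_s i ^ ((incidence_matrix l L *v a) $ i)))"

lemma mfps_X_prod_supp:
  fixes f :: "('m option, int) mfps"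
  assumes "finite I" and "mfps_nth (f * (\<Prod>i\<in>I. hilb_s i ^ e i)) w \<noteq> 0"
  shows "\<exists>u. mfps_nth f u \<noteq> 0 \<and>
    (\<forall>x. Poly_Mapping.lookup u x \<le> Poly_Mapping.lookup w x) \<and>
    (\<forall>i\<in>I. e i \<le> Poly_Mapping.lookup w (Some i))"
  using assms
proof (induction I arbitrary: w)
  case empty
  then have "mfps_nth f w \<noteq> 0" by simp
  then show ?case by blast
next
  case (insert i I)
  let ?P = "\<Prod>i\<in>I. hilb_s i ^ e i"
  have "f * (\<Prod>i\<in>insert i I. hilb_s i ^ e i) = (f * ?P) * hilb_s i ^ e i"
    using insert.hyps by (simp add: mult_ac)
  then have "mfps_nth ((f * ?P) * hilb_s i ^ e i) w \<noteq> 0"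
    using insert.prems by simp
  from mfps_X_power_prod_supp[OF this] obtain v where
    v: "w = v + Poly_Mapping.single (Some i) (e i)" "mfps_nth (f * ?P) v \<noteq> 0"
    by blast
  have le: "Poly_Mapping.lookup v x \<le> Poly_Mapping.lookup w x" for x
    by (simp add: v(1) lookup_add)
  have i: "e i \<le> Poly_Mapping.lookup w (Some i)"
    by (simp add: v(1) lookup_add)
  from insert.IH[OF v(2)] obtain u where u: "mfps_nth f u \<noteq> 0"
    "\<And>x. Poly_Mapping.lookup u x \<le> Poly_Mapping.lookup v x"
    "\<And>i. i \<in> I \<Longrightarrow> e i \<le> Poly_Mapping.lookup v (Some i)"
    by blast
  show ?case
  proof (intro exI[of _ u] conjI allI ballI)
    show "Poly_Mapping.lookup u x \<le> Poly_Mapping.lookup w x" for x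
      using u(2) le by (rule le_trans)
    show "e k \<le> Poly_Mapping.lookup w (Some k)" if "k \<in> insert i I" for k
      using that i u(3)[of k] le[of "Some k"] by auto
  qed (fact u(1))
qed

lemma zonotopal_cox_hilb_summable:
  fixes l :: "'n::finite \<Rightarrow> complex ^ 'r" and L :: "'m::finite \<Rightarrow> (complex ^ 'r) set"
  assumes "arrangement l" and "essential l" and "bij_betw L UNIV (arr_lines l)"
  shows "finite {(d, a). mfps_nth
    (of_nat (cpoly.dim (zonotopal_cox_component l L h d a)) * hilb_t ^ d *
      (\<Prod>i\<in>UNIV. hilb_s i ^ ((incidence_matrix l L *v a) $ i))) w \<noteq> 0}" (is "finite ?A")
proof -
  define N where "N = (\<Sum>x\<in>UNIV. Poly_Mapping.lookup w x)"
  have leN: "Poly_Mapping.lookup w x \<le> N" for x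
    unfolding N_def by (rule member_le_sum) auto
  have "d \<le> N \<and> (\<forall>j. a $ j \<le> N)" if "(d, a) \<in> ?A" for d a
  proof -
    let ?H = "incidence_matrix l L"
    from that have nz: "mfps_nth
      (of_nat (cpoly.dim (zonotopal_cox_component l L h d a)) * hilb_t ^ d *
        (\<Prod>i\<in>UNIV. hilb_s i ^ ((?H *v a) $ i))) w \<noteq> 0" by blast
    from mfps_X_prod_supp[OF finite nz] obtain u where
      u: "mfps_nth
        (of_nat (cpoly.dim (zonotopal_cox_component l L h d a)) * hilb_t ^ d) u \<noteq> 0"
        "\<And>x. Poly_Mapping.lookup u x \<le> Poly_Mapping.lookup w x"
      and s: "\<And>i. (?H *v a) $ i \<le> Poly_Mapping.lookup w (Some i)"
      by blast
    from mfps_X_power_prod_supp[OF u(1)] have "d \<le> Poly_Mapping.lookup u None"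
      by (auto simp: lookup_add)
    then have "d \<le> N"
      using u(2)[of None] leN[of None] by linarith
    moreover have "a $ j \<le> N" for j
    proof -
      obtain K where "K \<in> arr_lines l" "\<not> K \<subseteq> hyperplane_of (l j)"
        using line_not_subset_hyperplane[of l j] assms by (auto simp: arrangement_def)
      then obtain i where i: "\<not> L i \<subseteq> hyperplane_of (l j)"
        using assms(3) by (metis bij_betw_def imageE)
      have "a $ j = ?H $ i $ j * a $ j"
        using i by (simp add: incidence_matrix_def)
      also have "\<dots> \<le> (?H *v a) $ i"
        unfolding matrix_vector_mult_def vec_lambda_beta
        by (rule member_le_sum[of j UNIV "\<lambda>j. ?H $ i $ j * a $ j"]) auto
      also have "\<dots> \<le> N"
        using s leN le_trans by blast
      finally show ?thesis .
    qed
    ultimately show ?thesis by blast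
  qed
  note bound = this
  let ?F = "{f :: 'n \<Rightarrow> nat. \<forall>j. (j \<in> UNIV \<longrightarrow> f j \<in> {..N}) \<and> (j \<notin> UNIV \<longrightarrow> f j = 0)}"
  have "?A \<subseteq> {..N} \<times> vec_lambda ` ?F"
  proof
    fix x
    assume x: "x \<in> ?A"
    obtain d a where da: "x = (d, a)"
      by (cases x)
    have "d \<le> N" "\<forall>j. a $ j \<le> N"
      using bound[of d a] x unfolding da by blast+
    then have "d \<in> {..N}" "($) a \<in> ?F"
      by simp_all
    then show "x \<in> {..N} \<times> vec_lambda ` ?F"
      unfolding da using imageI[of "($) a" ?F vec_lambda] unfolding vec_lambda_eta by (intro SigmaI)
  qed
  moreover have "finite ?F"
    by (intro finite_set_of_finite_funs) auto
  then have "finite ({..N} \<times> vec_lambda ` ?F)"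
    by (intro finite_cartesian_product finite_imageI finite_atMost)
  ultimately show ?thesis
    by (rule finite_subset)
qed

definition hyperplane_monom ::
    "('n::finite \<Rightarrow> complex ^ 'r) \<Rightarrow> ('m::finite \<Rightarrow> (complex ^ 'r) set) \<Rightarrow> 'n \<Rightarrow> ('m option, int) mfps"
  where "hyperplane_monom l L j = (\<Prod>i | \<not> L i \<subseteq> hyperplane_of (l j). hilb_s i)"

end

theory Submission
  imports Defs "HOL-Library.Function_Algebras"
begin

text \<open>
  Setting \<open>s = 1\<close> identifies the invariants of degree \<open>(d, H a)\<close> with the homogeneous polynomial
  functions of degree \<open>d\<close> on \<open>V\<close> whose degree along each line \<open>h\<^sub>i\<close> is at most \<open>(H a)\<^sub>i\<close>. Consider the
  analogous space on every flat. If \<open>l\<^sub>j\<close> does not vanish on the flat and \<open>a\<^sub>j > 0\<close>, then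
  multiplication by \<open>l\<^sub>j\<close> and restriction to the hyperplane form a short exact sequence; restriction
  is onto because, inductively, every such function is a combination of the products of linear
  forms \<open>l\<^sup>b\<close> with \<open>b \<le> a\<close>. Hence the dimensions satisfy a deletion-contraction recursion whose
  solution is \<open>\<Sum>E. (1 - t)\<^bsup>- r(E)\<^esup> (\<Prod>e\<in>E. 1 - t\<^bsup>a(e)\<^esup>) (\<Prod>e\<notin>E. t\<^bsup>a(e)\<^esup>)\<close>, and summing
  over \<open>a\<close> turns each factor into a geometric series.
\<close>

section \<open>Dimension counts\<close>

text \<open>At \<open>s = 1\<close> the group translates \<open>t\<close> by the linear relations
  among the \<open>h i\<close>, so an invariant depends only on the vector
  \<open>\<Sum>i. t i *s h i\<close>; the lines span \<open>V\<close> because the arrangement is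
  essential. In a fixed degree the exponent of \<open>t i\<close> determines that of
  \<open>s i\<close>, and nonnegativity of the latter is the degree bound along \<open>h i\<close>.
  That every bounded function comes from an invariant is not evident. It follows from generation by
  products of forms, since each form \<open>l j\<close> has an explicit invariant lift of degree (1,
  H e_j). Generation on all flats is therefore proved before any dimension is counted, and it is
  used twice: for restriction being onto and for the passage to \<open>s = 1\<close> being onto. On
  the hyperplane section by \<open>l j\<close> the multiplicity \<open>a j\<close> no longer affects
  the bounds, so contraction keeps \<open>a\<close> and only enlarges \<open>B\<close>. The
  recursion ends when every form of positive multiplicity vanishes on the flat, where only constants
  survive. In the closed form the two weights of each \<open>e\<close> add up to 1, and contraction
  lowers the rank by one; a factor \<open>q\<close> per unit of rank fits the recursion by
  \<open>q * (1 - t) = 1\<close>.\<close>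

definition (in vector_space) has_dim :: "'b set \<Rightarrow> nat \<Rightarrow> bool"
  where "has_dim V n \<longleftrightarrow> (\<exists>S. finite S \<and> independent S \<and> span S = V \<and> card S = n)"

text \<open>The bridge back to \<open>dim\<close>, which is total and says nothing about finiteness;
  all counting is done with \<open>has_dim\<close>.\<close>

lemma (in vector_space) dim_eq_has_dim: "has_dim V n \<Longrightarrow> dim V = n"
  unfolding has_dim_def by (metis dim_eq_card_independent dim_span)

lemma (in vector_space) has_dim_0: "has_dim {0} 0"
  unfolding has_dim_def by (intro exI[of _ "{}"]) (auto simp: independent_empty)

lemma (in vector_space_pair) has_dim_image:
  assumes T: "Vector_Spaces.linear s1 s2 T" and "vs1.has_dim V n" "inj_on T V"
  shows "vs2.has_dim (T ` V) n"
proof -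
  obtain S where S: "finite S" "vs1.independent S" "vs1.span S = V" "card S = n"
    using assms(2) unfolding vs1.has_dim_def by blast
  have "vs2.independent (T ` S)"
    using linear_independent_injective_image[OF T S(2)] assms(3) S(3) by simp
  moreover have "vs2.span (T ` S) = T ` V"
    using linear_span_image[OF T] S(3) by simp
  moreover have "card (T ` S) = n"
    using S assms(3) by (metis card_image inj_on_subset vs1.span_superset)
  ultimately show ?thesis
    using S(1) unfolding vs2.has_dim_def by blast
qed

text \<open>Rank-nullity, with finite-dimensionality of \<open>V\<close> as part of the conclusion:
  a basis of the kernel together with preimages \<open>g s\<close> of a basis of the image is a
  basis of \<open>V\<close>.\<close>

lemma (in vector_space_pair) has_dim_kernel_image:
  assumes T: "Vector_Spaces.linear s1 s2 T" and V: "vs1.subspace V"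
    and K: "vs1.has_dim {v \<in> V. T v = 0} k" and W: "vs2.has_dim (T ` V) n"
  shows "vs1.has_dim V (k + n)"
proof -
  obtain S0 where S0: "finite S0" "vs1.independent S0" "vs1.span S0 = {v \<in> V. T v = 0}" "card S0 = k"
    using K unfolding vs1.has_dim_def by blast
  obtain S1 where S1: "finite S1" "vs2.independent S1" "vs2.span S1 = T ` V" "card S1 = n"
    using W unfolding vs2.has_dim_def by blast
  have "S1 \<subseteq> T ` V"
    using S1(3) vs2.span_superset by blast
  then have "\<exists>g. \<forall>s\<in>S1. g s \<in> V \<and> T (g s) = s"
    by (intro bchoice) auto
  then obtain g where g: "\<And>s. s \<in> S1 \<Longrightarrow> g s \<in> V" "\<And>s. s \<in> S1 \<Longrightarrow> T (g s) = s"
    by blast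
  have inj: "inj_on g S1"
    by (metis g(2) inj_on_inverseI)
  have TgS: "T ` g ` S1 = S1"
    using g(2) by (force simp: image_image)
  have S0V: "v \<in> V" "T v = 0" if "v \<in> S0" for v
    using that S0(3) vs1.span_superset by blast+
  have disj: "S0 \<inter> g ` S1 = {}"
  proof -
    have False if "g s \<in> S0" "s \<in> S1" for s
      using that S0V(2)[of "g s"] g(2)[of s] S1(2) vs2.dependent_zero by metis
    then show ?thesis by blast
  qed
  have "vs1.span (S0 \<union> g ` S1) = V"
  proof
    show "vs1.span (S0 \<union> g ` S1) \<subseteq> V"
      using S0V g(1) V by (intro vs1.span_minimal) auto
    show "V \<subseteq> vs1.span (S0 \<union> g ` S1)"
    proof
      fix v assume v: "v \<in> V"
      then have "T v \<in> T ` vs1.span (g ` S1)"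
        using linear_span_image[OF T, of "g ` S1"] TgS S1(3) by auto
      then obtain w where w: "w \<in> vs1.span (g ` S1)" "T v = T w" by blast
      have "w \<in> V"
        using w(1) g(1) vs1.span_minimal[OF _ V, of "g ` S1"] by blast
      then have "v - w \<in> vs1.span S0"
        unfolding S0(3) using v V w(2) by (simp add: vs1.subspace_diff linear_diff[OF T])
      then have "(v - w) + w \<in> vs1.span (S0 \<union> g ` S1)"
        using w(1) by (meson Un_upper1 Un_upper2 subsetD vs1.span_add vs1.span_mono)
      then show "v \<in> vs1.span (S0 \<union> g ` S1)" by simp
    qed
  qed
  moreover have "vs1.independent (S0 \<union> g ` S1)"
  proof (rule vs1.independent_if_scalars_zero)
    show "finite (S0 \<union> g ` S1)" using S0 S1 by simp
    fix f x assume 0: "(\<Sum>x\<in>S0 \<union> g ` S1. s1 (f x) x) = 0" and x: "x \<in> S0 \<union> g ` S1"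
    have sum: "(\<Sum>x\<in>S0. s1 (f x) x) + (\<Sum>s\<in>S1. s1 (f (g s)) (g s)) = 0"
      using 0 S0(1) S1(1) disj by (simp add: sum.union_disjoint sum.reindex[OF inj])
    have "T (\<Sum>x\<in>S0. s1 (f x) x) = 0"
      using S0V(2) by (simp add: linear_sum[OF T] linear_scale[OF T])
    moreover have "T (\<Sum>s\<in>S1. s1 (f (g s)) (g s)) = (\<Sum>s\<in>S1. s2 (f (g s)) s)"
      using g(2) by (simp add: linear_sum[OF T] linear_scale[OF T])
    ultimately have "(\<Sum>s\<in>S1. s2 (f (g s)) s) = 0"
      using arg_cong[OF sum, of T] by (simp add: linear_add[OF T] linear_0[OF T])
    then have f1: "f (g s) = 0" if "s \<in> S1" for s
      using vs2.independentD[OF S1(2,1) subset_refl, of "\<lambda>s. f (g s)"] that by simp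
    then have "(\<Sum>x\<in>S0. s1 (f x) x) = 0"
      using sum by simp
    then have "f x = 0" if "x \<in> S0" for x
      using vs1.independentD[OF S0(2,1) subset_refl, of f] that by simp
    with f1 x show "f x = 0" by blast
  qed
  moreover have "card (S0 \<union> g ` S1) = k + n"
    using S0 S1 disj by (simp add: card_Un_disjoint card_image[OF inj])
  ultimately show ?thesis
    unfolding vs1.has_dim_def using S0(1) S1(1)
    by (intro exI[of _ "S0 \<union> g ` S1"] conjI finite_UnI finite_imageI)
qed

section \<open>Truncation of power series\<close>

definition total_degree :: "('v \<Rightarrow>\<^sub>0 nat) \<Rightarrow> nat"
  where "total_degree w = (\<Sum>x\<in>Poly_Mapping.keys w. Poly_Mapping.lookup w x)"

lemma total_degree_superset:
  assumes "finite K" "Poly_Mapping.keys w \<subseteq> K"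
  shows "total_degree w = (\<Sum>x\<in>K. Poly_Mapping.lookup w x)"
  unfolding total_degree_def using assms by (intro sum.mono_neutral_left) (auto simp: in_keys_iff)

lemma total_degree_add: "total_degree (i + j) = total_degree i + total_degree j"
proof -
  let ?K = "Poly_Mapping.keys i \<union> Poly_Mapping.keys j"
  have "total_degree (i + j) = (\<Sum>x\<in>?K. Poly_Mapping.lookup (i + j) x)"
    by (intro total_degree_superset Poly_Mapping.keys_add) auto
  also have "\<dots> = total_degree i + total_degree j"
    by (simp add: lookup_add sum.distrib total_degree_superset[of ?K])
  finally show ?thesis .
qed

lemma total_degree_pos: "i \<noteq> 0 \<Longrightarrow> total_degree i > 0"
  by (auto simp: total_degree_def in_keys_iff intro!: sum_pos)

text \<open>Congruence modulo the ideal of series without terms of total degree below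
  \<open>N\<close>. It replaces convergence: an identity of series is checked at one exponent, with
  \<open>N\<close> just above its degree.\<close>

definition agree :: "nat \<Rightarrow> ('v, 'a) mfps \<Rightarrow> ('v, 'a) mfps \<Rightarrow> bool"
  where "agree N f g \<longleftrightarrow> (\<forall>w. total_degree w < N \<longrightarrow> mfps_nth f w = mfps_nth g w)"

lemma agree_refl [simp]: "agree N f f"
  by (simp add: agree_def)

lemma mfps_nth_simps [simp]:
  fixes f g :: "('v, 'a::comm_ring_1) mfps"
  shows "mfps_nth (f + g) w = mfps_nth f w + mfps_nth g w"
    "mfps_nth (f - g) w = mfps_nth f w - mfps_nth g w"
    "mfps_nth (0 :: ('v, 'a) mfps) w = 0"
    "mfps_nth (1 :: ('v, 'a) mfps) w = (if w = 0 then 1 else 0)"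
  by (simp_all add: plus_mfps_def minus_mfps_def zero_mfps_def one_mfps_def)

lemma mfps_nth_sum:
  fixes F :: "'i \<Rightarrow> ('v, 'a::comm_ring_1) mfps"
  shows "mfps_nth (sum F A) w = (\<Sum>k\<in>A. mfps_nth (F k) w)"
  by (induction A rule: infinite_finite_induct) auto

lemma mfps_nth_mult_0:
  fixes f g :: "('v, 'a::comm_ring_1) mfps"
  shows "mfps_nth (f * g) 0 = mfps_nth f 0 * mfps_nth g 0"
proof -
  have 0: "i + j = 0 \<longleftrightarrow> i = 0 \<and> j = 0" for i j :: "'v \<Rightarrow>\<^sub>0 nat"
  proof
    assume "i + j = 0"
    then have "total_degree i + total_degree j = 0"
      using total_degree_add[of i j] by (simp add: total_degree_def)
    then show "i = 0 \<and> j = 0"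
      using total_degree_pos[of i] total_degree_pos[of j] by fastforce
  qed simp
  have "{(i, j). i + j = (0 :: 'v \<Rightarrow>\<^sub>0 nat)} = {(0, 0)}"
    by (auto simp: 0)
  then show ?thesis
    by (simp add: times_mfps_def)
qed

lemma agree_add:
  fixes f g f' g' :: "('v, 'a::comm_ring_1) mfps"
  shows "agree N f f' \<Longrightarrow> agree N g g' \<Longrightarrow> agree N (f + g) (f' + g')"
  by (simp add: agree_def)

lemma agree_diff:
  fixes f g f' g' :: "('v, 'a::comm_ring_1) mfps"
  shows "agree N f f' \<Longrightarrow> agree N g g' \<Longrightarrow> agree N (f - g) (f' - g')"
  by (simp add: agree_def)

lemma agree_mult:
  fixes f g f' g' :: "('v, 'a::comm_ring_1) mfps"
  assumes "agree N f f'" "agree N g g'"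
  shows "agree N (f * g) (f' * g')"
  using assms unfolding agree_def times_mfps_def mfps_nth_Abs
  by (auto intro!: sum.cong simp: total_degree_add)

lemma agree_sum:
  fixes F G :: "'i \<Rightarrow> ('v, 'a::comm_ring_1) mfps"
  shows "(\<And>x. x \<in> A \<Longrightarrow> agree N (F x) (G x)) \<Longrightarrow> agree N (sum F A) (sum G A)"
  by (induction A rule: infinite_finite_induct) (auto intro: agree_add)

lemma agree_prod:
  fixes F G :: "'i \<Rightarrow> ('v, 'a::comm_ring_1) mfps"
  shows "(\<And>x. x \<in> A \<Longrightarrow> agree N (F x) (G x)) \<Longrightarrow> agree N (prod F A) (prod G A)"
  by (induction A rule: infinite_finite_induct) (auto intro: agree_mult)

lemma agree_power_0:
  fixes f :: "('v, 'a::comm_ring_1) mfps"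
  assumes "mfps_nth f 0 = 0"
  shows "agree k (f ^ k) 0"
proof (induction k)
  case 0
  show ?case by (simp add: agree_def)
next
  case (Suc k)
  have "mfps_nth (f * f ^ k) w = 0" if "total_degree w < Suc k" for w
  proof -
    have "mfps_nth f i * mfps_nth (f ^ k) j = 0" if "i + j = w" for i j
    proof (cases "i = 0")
      case True
      then show ?thesis by (simp add: assms)
    next
      case False
      then have "total_degree j < k"
        using that \<open>total_degree w < Suc k\<close> total_degree_pos[of i] total_degree_add[of i j] by simp
      then show ?thesis using Suc.IH by (simp add: agree_def)
    qed
    then show ?thesis
      unfolding times_mfps_def[of f] mfps_nth_Abs by (intro sum.neutral) auto
  qed
  then show ?case by (simp add: agree_def)
qed

lemma agree_mono: "agree N f g \<Longrightarrow> M \<le> N \<Longrightarrow> agree M f g"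
  by (simp add: agree_def)

lemma agree_geometric:
  fixes f :: "('v, 'a::comm_ring_1) mfps"
  assumes "mfps_nth f 0 = 0"
  shows "agree N (\<Sum>k<N. f ^ k) (inverse (1 - f))"
proof -
  have unit: "(1 - f) * inverse (1 - f) = 1"
    using assms by (intro mfps_is_unit) simp
  have "(\<Sum>k<N. f ^ k) = (\<Sum>k<N. f ^ k) * ((1 - f) * inverse (1 - f))"
    by (simp add: unit)
  also have "\<dots> = inverse (1 - f) * (1 - f ^ N)"
    by (simp add: one_diff_power_eq mult_ac)
  finally show ?thesis
    using agree_mult[OF agree_refl agree_diff[OF agree_refl agree_power_0[OF assms]], of N "inverse (1 - f)" 1]
    by simp
qed

section \<open>Homogeneous polynomial functions\<close>

definition fun_scale :: "complex \<Rightarrow> ('v \<Rightarrow> complex) \<Rightarrow> 'v \<Rightarrow> complex"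
  where "fun_scale c f = (\<lambda>x. c * f x)"

global_interpretation fn: vector_space fun_scale
  by unfold_locales (auto simp: fun_scale_def plus_fun_def algebra_simps)

global_interpretation fn_pair: vector_space_pair fun_scale fun_scale ..

global_interpretation cpoly_fn: vector_space_pair cpoly_scale fun_scale ..

definition lform :: "complex ^ 'r \<Rightarrow> complex ^ 'r \<Rightarrow> complex"
  where "lform m x = (\<Sum>k\<in>UNIV. m $ k * x $ k)"

lemma hyperplane_of_lform: "hyperplane_of m = {x. lform m x = 0}"
  by (simp add: hyperplane_of_def lform_def)

lemma lform_add_right: "lform m (x + y) = lform m x + lform m y"
  by (simp add: lform_def algebra_simps sum.distrib)

lemma lform_scale_right: "lform m (c *s x) = c * lform m x"
  by (simp add: lform_def algebra_simps sum_distrib_left)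

lemma lform_add_left: "lform (m + m') x = lform m x + lform m' x"
  by (simp add: lform_def algebra_simps sum.distrib)

lemma lform_scale_left: "lform (c *s m) x = c * lform m x"
  by (simp add: lform_def algebra_simps sum_distrib_left)

lemma lform_diff_left: "lform (m - m') x = lform m x - lform m' x"
  by (simp add: lform_def algebra_simps sum_subtractf)

lemma lform_diff_right: "lform m (x - y) = lform m x - lform m y"
  by (simp add: lform_def algebra_simps sum_subtractf)

lemma lform_0_right [simp]: "lform m 0 = 0"
  by (simp add: lform_def)

lemma lform_0_left [simp]: "lform 0 x = 0"
  by (simp add: lform_def)

lemma lform_axis: "lform (axis k 1) x = x $ k"
  by (simp add: lform_def axis_def if_distrib[of "\<lambda>u. u * _"] cong: if_cong)

lemma lform_sum_right: "lform m (\<Sum>i\<in>I. f i) = (\<Sum>i\<in>I. lform m (f i))"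
  by (induction I rule: infinite_finite_induct) (auto simp: lform_add_right)

lemma continuous_on_lform [continuous_intros]:
  "continuous_on S f \<Longrightarrow> continuous_on S (\<lambda>x. lform m (f x))"
  unfolding lform_def by (intro continuous_intros)

text \<open>A hyperplane that misses a point \<open>v\<close> of \<open>U\<close> has dense
  complement in \<open>U\<close>: for \<open>x\<close> on it, the points
  \<open>x + s n *\<^sub>R v\<close> lie off it and tend to \<open>x\<close>. This permits
  cancelling a linear form from an identity of functions on a flat.\<close>

lemma continuous_zero_off_hyperplane:
  assumes F: "continuous_on UNIV (F :: complex ^ 'r \<Rightarrow> complex)" and U: "vec.subspace U"
    and v: "v \<in> U" "lform m v \<noteq> 0" and x: "x \<in> U"
    and off: "\<And>y. y \<in> U \<Longrightarrow> lform m y \<noteq> 0 \<Longrightarrow> F y = 0"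
  shows "F x = 0"
proof (cases "lform m x = 0")
  case True
  define s where "s n = inverse (real (Suc n))" for n
  have scale: "s n *\<^sub>R v = complex_of_real (s n) *s v" for n
    by (simp only: vec_eq_iff vector_scaleR_component vector_smult_component)
      (simp add: scaleR_conv_of_real)
  have "F (x + s n *\<^sub>R v) = 0" for n
  proof (rule off)
    show "x + s n *\<^sub>R v \<in> U"
      unfolding scale using U v(1) x by (intro vec.subspace_add vec.subspace_scale)
    have "s n \<noteq> 0" by (simp add: s_def)
    then show "lform m (x + s n *\<^sub>R v) \<noteq> 0"
      unfolding scale using True v(2) by (simp add: lform_add_right lform_scale_right)
  qed
  moreover have "(\<lambda>n. F (x + s n *\<^sub>R v)) \<longlonglongrightarrow> F (x + 0 *\<^sub>R v)"
  proof (rule isCont_tendsto_compose[where g = F])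
    show "isCont F (x + 0 *\<^sub>R v)"
      using F by (simp add: continuous_on_eq_continuous_at)
    have "s \<longlonglongrightarrow> 0"
      unfolding s_def by (rule LIMSEQ_inverse_real_of_nat)
    then show "(\<lambda>n. x + s n *\<^sub>R v) \<longlonglongrightarrow> x + 0 *\<^sub>R v"
      by (intro tendsto_intros)
  qed
  ultimately show ?thesis
    by (simp add: LIMSEQ_const_iff)
qed (use off x in blast)

text \<open>Homogeneous polynomial functions without coordinates, as sums of products of linear
  forms; factorisation and restriction to lines then go by rule induction.\<close>

inductive hpoly :: "nat \<Rightarrow> (complex ^ 'r \<Rightarrow> complex) \<Rightarrow> bool" where
  const: "hpoly 0 (\<lambda>x. c)"
| mult: "hpoly d f \<Longrightarrow> hpoly (Suc d) (\<lambda>x. lform m x * f x)"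
| add: "hpoly d f \<Longrightarrow> hpoly d g \<Longrightarrow> hpoly d (\<lambda>x. f x + g x)"

lemma hpoly_scale: "hpoly d f \<Longrightarrow> hpoly d (\<lambda>x. c * f x)"
proof (induction rule: hpoly.induct)
  case (const a)
  show ?case by (rule hpoly.const)
next
  case (mult d f m)
  then have "hpoly (Suc d) (\<lambda>x. lform m x * (c * f x))"
    by (intro hpoly.mult)
  then show ?case by (simp add: mult_ac)
next
  case (add d f g)
  then show ?case using hpoly.add by (simp add: distrib_left)
qed

lemma hpoly_zero: "hpoly d (\<lambda>x. 0)"
proof (induction d)
  case 0
  show ?case by (rule hpoly.const)
next
  case (Suc d)
  from hpoly.mult[OF this, of 0] show ?case by simp
qed

lemma hpoly_degree_0: "hpoly d f \<Longrightarrow> d = 0 \<Longrightarrow> f x = f y"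
  by (induction rule: hpoly.induct) auto

lemma hpoly_at_0: "hpoly d f \<Longrightarrow> d \<noteq> 0 \<Longrightarrow> f 0 = 0"
  by (induction rule: hpoly.induct) auto

lemma continuous_on_hpoly: "hpoly d f \<Longrightarrow> continuous_on UNIV f"
  by (induction rule: hpoly.induct) (auto intro!: continuous_intros)

text \<open>The polynomial in \<open>c\<close> has coefficients continuous in the base point, so a
  coefficient that vanishes at generic base points vanishes everywhere;
  \<open>deg_along_lform_divide\<close> relies on this.\<close>

lemma hpoly_on_line:
  assumes "hpoly d f"
  shows "\<exists>Q. (\<forall>k. continuous_on UNIV (\<lambda>x. coeff (Q x) k)) \<and> (\<forall>x c. f (x + c *s h) = poly (Q x) c)"
  using assms
proof (induction rule: hpoly.induct)
  case (const c)
  show ?case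
    by (intro exI[of _ "\<lambda>x. [:c:]"]) (auto intro!: continuous_intros)
next
  case (mult d f m)
  then obtain Q where Q: "\<And>k. continuous_on UNIV (\<lambda>x. coeff (Q x) k)"
    "\<And>x c. f (x + c *s h) = poly (Q x) c"
    by blast
  have "continuous_on UNIV (\<lambda>x. coeff (smult (lform m x) (Q x) + pCons 0 (smult (lform m h) (Q x))) k)" for k
    by (cases k) (auto intro!: continuous_intros Q(1))
  then show ?case
    by (intro exI[of _ "\<lambda>x. smult (lform m x) (Q x) + pCons 0 (smult (lform m h) (Q x))"])
      (simp add: Q(2) lform_add_right lform_scale_right algebra_simps)
next
  case (add d f g)
  then obtain Q R where Q: "\<And>k. continuous_on UNIV (\<lambda>x. coeff (Q x) k)"
    "\<And>x c. f (x + c *s h) = poly (Q x) c"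
    and R: "\<And>k. continuous_on UNIV (\<lambda>x. coeff (R x) k)"
    "\<And>x c. g (x + c *s h) = poly (R x) c"
    by blast
  then show ?case
    by (intro exI[of _ "\<lambda>x. Q x + R x"]) (auto intro!: continuous_intros)
qed

text \<open>\<open>x - lform m x *s v\<close> projects onto the kernel of \<open>m\<close> along
  \<open>v\<close>, and \<open>f\<close> agrees with its pullback on that kernel, so the difference
  is divisible by \<open>m\<close>. For \<open>d = 0\<close> the truncated \<open>d - 1\<close> is
  again 0, hence the separate clause that the quotient is zero.\<close>

lemma hpoly_factor:
  assumes "hpoly d f" and v: "lform m v = 1"
  shows "\<exists>g. hpoly (d - 1) g \<and> (d = 0 \<longrightarrow> g = (\<lambda>x. 0)) \<and>
    (\<forall>x. f x = f (x - lform m x *s v) + lform m x * g x)"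
  using assms(1)
proof (induction rule: hpoly.induct)
  case (const c)
  show ?case
    by (intro exI[of _ "\<lambda>x. 0"]) (auto intro: hpoly_zero)
next
  case (mult d f k)
  then obtain g where g: "hpoly (d - 1) g" "d = 0 \<Longrightarrow> g = (\<lambda>x. 0)"
    "\<And>x. f x = f (x - lform m x *s v) + lform m x * g x"
    by blast
  \<comment> \<open>\<open>?k\<close> is the part of \<open>k\<close> that kills \<open>v\<close>,
    so \<open>k\<close> after the projection is \<open>?k\<close>; expanding the product then gives
    the quotient \<open>?g\<close>.\<close>
  let ?k = "k - lform k v *s m"
  let ?g = "\<lambda>x. lform ?k x * g x + lform k v * f x"
  have "hpoly d ?g"
  proof (cases d)
    case 0
    then show ?thesis using g(2) mult.hyps by (simp add: hpoly_scale)
  next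
    case (Suc e)
    then have "hpoly d (\<lambda>x. lform ?k x * g x)"
      using g(1) hpoly.mult by auto
    then show ?thesis
      by (intro hpoly.add hpoly_scale mult.hyps)
  qed
  moreover have "lform k x * f x =
      lform k (x - lform m x *s v) * f (x - lform m x *s v) + lform m x * ?g x" for x
  proof -
    have "lform k (x - lform m x *s v) = lform ?k x"
      by (simp add: lform_diff_left lform_diff_right lform_scale_left lform_scale_right)
    moreover have "lform k x = lform ?k x + lform k v * lform m x"
      by (simp add: lform_diff_left lform_scale_left)
    moreover have "f (x - lform m x *s v) = f x - lform m x * g x"
      using g(3)[of x] by simp
    ultimately show ?thesis
      by (simp only:) (simp add: algebra_simps)
  qed
  ultimately show ?case
    unfolding diff_Suc_1 by (intro exI[of _ ?g] conjI) blast+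
next
  case (add d f1 f2)
  then obtain g1 g2 where g: "hpoly (d - 1) g1" "d = 0 \<Longrightarrow> g1 = (\<lambda>x. 0)"
    "\<And>x. f1 x = f1 (x - lform m x *s v) + lform m x * g1 x"
    "hpoly (d - 1) g2" "d = 0 \<Longrightarrow> g2 = (\<lambda>x. 0)"
    "\<And>x. f2 x = f2 (x - lform m x *s v) + lform m x * g2 x"
    by blast
  have "f1 x + f2 x = (f1 (x - lform m x *s v) + f2 (x - lform m x *s v)) + lform m x * (g1 x + g2 x)" for x
    using g(3)[of x] g(6)[of x] by (simp add: algebra_simps)
  then show ?case
    using g(2,5) by (intro exI[of _ "\<lambda>x. g1 x + g2 x"] conjI hpoly.add[OF g(1) g(4)]) (simp, blast)
qed

section \<open>Degree of a function in the direction of a line\<close>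

definition deg_along :: "(complex ^ 'r) set \<Rightarrow> (complex ^ 'r \<Rightarrow> complex) \<Rightarrow> complex ^ 'r \<Rightarrow> nat \<Rightarrow> bool"
  where "deg_along U f h u \<longleftrightarrow> (\<forall>x\<in>U. \<exists>p. degree p \<le> u \<and> (\<forall>c. f (x + c *s h) = poly p c))"

lemma deg_along_const: "deg_along U (\<lambda>x. a) h u"
  unfolding deg_along_def by (intro ballI exI[of _ "[:a:]"]) simp

lemma deg_along_add:
  assumes "deg_along U f h u" "deg_along U g h u"
  shows "deg_along U (\<lambda>x. f x + g x) h u"
  unfolding deg_along_def
proof
  fix x assume "x \<in> U"
  then obtain p q where "degree p \<le> u" "\<And>c. f (x + c *s h) = poly p c"
    "degree q \<le> u" "\<And>c. g (x + c *s h) = poly q c"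
    using assms unfolding deg_along_def by blast
  then show "\<exists>p. degree p \<le> u \<and> (\<forall>c. f (x + c *s h) + g (x + c *s h) = poly p c)"
    by (intro exI[of _ "p + q"]) (auto intro: degree_add_le)
qed

lemma deg_along_scale:
  assumes "deg_along U f h u"
  shows "deg_along U (\<lambda>x. a * f x) h u"
  unfolding deg_along_def
proof
  fix x assume "x \<in> U"
  then obtain p where "degree p \<le> u" "\<And>c. f (x + c *s h) = poly p c"
    using assms unfolding deg_along_def by blast
  then show "\<exists>p. degree p \<le> u \<and> (\<forall>c. a * f (x + c *s h) = poly p c)"
    by (intro exI[of _ "smult a p"]) (auto intro: order.trans[OF degree_smult_le])
qed

lemma deg_along_lform_mult:
  assumes "deg_along U f h u"
  shows "deg_along U (\<lambda>x. lform m x * f x) h (of_bool (lform m h \<noteq> 0) + u)"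
  unfolding deg_along_def
proof
  fix x assume "x \<in> U"
  then obtain p where p: "degree p \<le> u" "\<And>c. f (x + c *s h) = poly p c"
    using assms unfolding deg_along_def by blast
  have "degree ([:lform m x, lform m h:] * p) \<le> of_bool (lform m h \<noteq> 0) + u"
    by (rule order.trans[OF degree_mult_le]) (use p(1) in simp)
  then show "\<exists>p. degree p \<le> of_bool (lform m h \<noteq> 0) + u \<and>
      (\<forall>c. lform m (x + c *s h) * f (x + c *s h) = poly p c)"
    by (intro exI[of _ "[:lform m x, lform m h:] * p"])
      (simp add: p(2) lform_add_right lform_scale_right algebra_simps)
qed

text \<open>If \<open>m\<close> is nonzero on \<open>h\<close>, it contributes exactly one to the
  degree along \<open>h\<close>. Otherwise it is constant along \<open>h\<close>: the bound passes
  to \<open>g\<close> at base points with \<open>lform m x \<noteq> 0\<close>, and continuity of the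
  coefficients carries it to the rest of \<open>U\<close>.\<close>

lemma deg_along_lform_divide:
  assumes g: "hpoly d g" and U: "vec.subspace U" "h \<in> U"
    and v: "v \<in> U" "lform m v \<noteq> 0"
    and f: "\<And>x. x \<in> U \<Longrightarrow> f x = lform m x * g x"
    and deg: "deg_along U f h (of_bool (lform m h \<noteq> 0) + u)"
  shows "deg_along U g h u"
proof -
  obtain Q where Q: "\<And>k. continuous_on UNIV (\<lambda>x. coeff (Q x) k)"
    "\<And>x c. g (x + c *s h) = poly (Q x) c"
    using hpoly_on_line[OF g] by blast
  have fact: "degree ([:lform m x, lform m h:] * Q x) \<le> of_bool (lform m h \<noteq> 0) + u"
    if x: "x \<in> U" for x
  proof -
    obtain p where p: "degree p \<le> of_bool (lform m h \<noteq> 0) + u" "\<And>c. f (x + c *s h) = poly p c"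
      using deg x unfolding deg_along_def by blast
    have "poly p c = poly ([:lform m x, lform m h:] * Q x) c" for c
    proof -
      have "x + c *s h \<in> U"
        using U x by (intro vec.subspace_add vec.subspace_scale)
      then show ?thesis
        using p(2)[of c] f[of "x + c *s h"] Q(2)[of x c]
        by (simp add: lform_add_right lform_scale_right algebra_simps)
    qed
    then have "p = [:lform m x, lform m h:] * Q x"
      by (metis poly_eq_poly_eq_iff ext)
    with p(1) show ?thesis by simp
  qed
  have "coeff (Q x) k = 0" if x: "x \<in> U" and k: "u < k" for x k
  proof (cases "lform m h = 0")
    case False
    have "degree (Q x) \<le> u"
    proof (cases "Q x = 0")
      case nz: False
      have "degree ([:lform m x, lform m h:] * Q x) = 1 + degree (Q x)"
        using nz False by (subst degree_mult_eq) auto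
      with fact[OF x] False show ?thesis by simp
    qed simp
    with k show ?thesis by (intro coeff_eq_0) simp
  next
    case True
    have "coeff (Q y) k = 0" if y: "y \<in> U" "lform m y \<noteq> 0" for y
    proof (rule coeff_eq_0)
      show "degree (Q y) < k"
        using fact[OF y(1)] y(2) True k by simp
    qed
    then show ?thesis
      by (rule continuous_zero_off_hyperplane[OF Q(1) U(1) v x])
  qed
  then show ?thesis
    unfolding deg_along_def using Q(2) by (metis degree_le)
qed

section \<open>Flats and the spaces attached to them\<close>

locale lines_arrangement =
  fixes l :: "'n::finite \<Rightarrow> complex ^ 'r" and h :: "'m::finite \<Rightarrow> complex ^ 'r"
  assumes essential: "essential l"
    and lines: "\<And>K. K \<in> arr_lines l \<Longrightarrow> \<exists>i. K = vec.span {h i}"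
begin

definition flat :: "'n set \<Rightarrow> (complex ^ 'r) set"
  where "flat B = {x. \<forall>j\<in>B. lform (l j) x = 0}"

lemma subspace_flat: "vec.subspace (flat B)"
  by (simp add: flat_def vec.subspace_def lform_add_right lform_scale_right)

lemma flat_insert: "flat (insert j B) = {x \<in> flat B. lform (l j) x = 0}"
  by (auto simp: flat_def)

lemma lform_span_eq_0:
  assumes "m \<in> vec.span (l ` B)" "x \<in> flat B"
  shows "lform m x = 0"
  using assms(1)
proof (induction rule: vec.span_induct_alt)
  case (step c y z)
  with assms(2) show ?case
    by (auto simp: flat_def lform_add_left lform_scale_left)
qed simp

text \<open>Duality: a linear map that kills a basis of the span of the forms of \<open>B\<close>
  and fixes \<open>m\<close> yields, through a coordinate \<open>k\<close> where \<open>m\<close> is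
  nonzero, a functional on forms. Such a functional is evaluation at a vector, which is then
  scaled.\<close>

lemma lform_separates:
  assumes "m \<notin> vec.span (l ` B)"
  obtains v where "v \<in> flat B" "lform m v = 1"
proof -
  obtain S where S: "S \<subseteq> l ` B" "vec.independent S" "l ` B \<subseteq> vec.span S"
    by (rule vec.basis_exists)
  have "m \<notin> vec.span S"
    using assms S(1) vec.span_mono by blast
  then have ind: "vec.independent (insert m S)" and "m \<notin> S"
    using S(2) vec.independent_insertI vec.span_superset by blast+
  have "m \<noteq> 0"
    using assms vec.span_zero by metis
  then obtain k where k: "m $ k \<noteq> 0"
    by (metis vec_eq_iff zero_index)
  obtain g where g: "Vector_Spaces.linear (*s) (*s) g"
      "\<And>x. x \<in> insert m S \<Longrightarrow> g x = (if x = m then m else 0)"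
    using vec.linear_independent_extend[OF ind, of "\<lambda>x. if x = m then m else 0"] by blast
  define v :: "complex ^ 'r" where "v = (\<chi> i. g (axis i 1) $ k)"
  have gv: "lform y v = g y $ k" for y
  proof -
    have "g y = g (\<Sum>i\<in>UNIV. y $ i *s axis i 1)"
      by (simp add: basis_expansion)
    also have "\<dots> = (\<Sum>i\<in>UNIV. y $ i *s g (axis i 1))"
      by (simp add: vec.linear_sum[OF g(1)] vec.linear_scale[OF g(1)])
    finally show ?thesis
      by (simp add: lform_def v_def)
  qed
  have zero: "g y = 0" if "y \<in> vec.span S" for y
    using that
  proof (induction rule: vec.span_induct_alt)
    case base
    show ?case by (rule vec.linear_0[OF g(1)])
  next
    case (step c x y)
    then show ?case
      using g(2)[of x] \<open>m \<notin> S\<close>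
      by (auto simp: vec.linear_add[OF g(1)] vec.linear_scale[OF g(1)])
  qed
  have "v \<in> flat B"
    using zero S(3) by (auto simp: flat_def gv)
  moreover have "lform m v \<noteq> 0"
    using g(2)[of m] k by (simp add: gv)
  ultimately have "inverse (lform m v) *s v \<in> flat B" "lform m (inverse (lform m v) *s v) = 1"
    by (simp_all add: vec.subspace_scale[OF subspace_flat] lform_scale_right)
  then show ?thesis by (rule that)
qed

lemma lform_nondegenerate:
  assumes "\<And>j. lform (l j) z = 0"
  shows "z = 0"
proof -
  have "z \<in> flat UNIV"
    using assms by (simp add: flat_def)
  then have "lform (axis k 1) z = 0" for k
    using essential by (intro lform_span_eq_0[of _ UNIV]) (simp_all add: essential_def)
  then show ?thesis
    by (simp add: vec_eq_iff lform_axis)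
qed

text \<open>
  In a flat of dimension at least two every point is the sum of two points of smaller flats.
\<close>

lemma flat_spanned_by_lines: "x \<in> flat B \<Longrightarrow> x \<in> vec.span {h i |i. h i \<in> flat B}"
proof (induction "card (- B)" arbitrary: B x rule: less_induct)
  case less
  have IH: "x \<in> vec.span {h i |i. h i \<in> flat B}" if "x \<in> flat (insert j B)" "j \<notin> B" for x j
  proof -
    have "card (- insert j B) < card (- B)"
      using \<open>j \<notin> B\<close> by (intro psubset_card_mono) auto
    then have "x \<in> vec.span {h i |i. h i \<in> flat (insert j B)}"
      using less.hyps that(1) by blast
    moreover have "{h i |i. h i \<in> flat (insert j B)} \<subseteq> {h i |i. h i \<in> flat B}"
      by (auto simp: flat_insert)
    ultimately show ?thesis
      using vec.span_mono by blast
  qed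
  show ?case
  proof (cases "x = 0")
    case True
    then show ?thesis by (simp add: vec.span_zero)
  next
    case False
    then obtain i where i: "lform (l i) x \<noteq> 0"
      using lform_nondegenerate by blast
    then have "i \<notin> B"
      using less.prems by (auto simp: flat_def)
    show ?thesis
    proof (cases "\<exists>z\<in>flat (insert i B). z \<noteq> 0")
      case True
      then obtain z where z: "z \<in> flat (insert i B)" "z \<noteq> 0" by blast
      then obtain j where j: "lform (l j) z \<noteq> 0"
        using lform_nondegenerate by blast
      then have "j \<notin> B"
        using z(1) by (auto simp: flat_def)
      \<comment> \<open>With this \<open>c\<close> the form \<open>l j\<close> kills
        \<open>x - c *s z\<close>, while \<open>z\<close> is killed by \<open>l i\<close>; so
        \<open>x - c *s z\<close> and \<open>c *s z\<close> both lie in smaller flats.\<close>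
      define c where "c = lform (l j) x / lform (l j) z"
      have "x - c *s z \<in> flat (insert j B)"
        using less.prems z(1) j subspace_flat
        by (auto simp: flat_insert c_def lform_diff_right lform_scale_right
            intro!: vec.subspace_diff vec.subspace_scale)
      then have "x - c *s z \<in> vec.span {h i |i. h i \<in> flat B}"
        using IH \<open>j \<notin> B\<close> by blast
      moreover have "c *s z \<in> vec.span {h i |i. h i \<in> flat B}"
        using IH[OF z(1) \<open>i \<notin> B\<close>] by (rule vec.span_scale)
      ultimately have "(x - c *s z) + c *s z \<in> vec.span {h i |i. h i \<in> flat B}"
        by (rule vec.span_add)
      then show ?thesis by simp
    next
      \<comment> \<open>The section by \<open>l i\<close> is zero, so the flat is the line through
        \<open>x\<close>; it is then a line of the arrangement and is spanned by some
        \<open>h k\<close>.\<close>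
      case no: False
      have "y \<in> vec.span {x}" if y: "y \<in> flat B" for y
      proof -
        define c where "c = lform (l i) y / lform (l i) x"
        have "y - c *s x \<in> flat (insert i B)"
          using less.prems y i subspace_flat
          by (auto simp: flat_insert c_def lform_diff_right lform_scale_right
              intro!: vec.subspace_diff vec.subspace_scale)
        then have "y = c *s x"
          using no by auto
        then show ?thesis
          by (metis vec.span_base vec.span_scale singletonI)
      qed
      moreover have "vec.span {x} \<subseteq> flat B"
        using less.prems subspace_flat by (intro vec.span_minimal) auto
      ultimately have eq: "flat B = vec.span {x}" by blast
      have "vec.dim (flat B) = 1"
        using False by (simp add: eq vec.dim_eq_card_independent)
      moreover have "flat B = (\<Inter>j\<in>B. hyperplane_of (l j))"
        by (auto simp: flat_def hyperplane_of_lform)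
      ultimately have "flat B \<in> arr_lines l"
        unfolding arr_lines_def by blast
      then obtain k where k: "flat B = vec.span {h k}"
        using lines by blast
      then have "h k \<in> flat B"
        by (simp add: vec.span_base)
      then have "vec.span {h k} \<subseteq> vec.span {h i |i. h i \<in> flat B}"
        by (intro vec.span_mono) blast
      with k less.prems show ?thesis by blast
    qed
  qed
qed

section \<open>Functions with bounded degrees on a flat\<close>

definition weight :: "('n \<Rightarrow> nat) \<Rightarrow> 'm \<Rightarrow> nat"
  where "weight a i = (\<Sum>j | lform (l j) (h i) \<noteq> 0. a j)"

lemma weight_upd_Suc:
  "weight (a(j := Suc (a j))) i = of_bool (lform (l j) (h i) \<noteq> 0) + weight a i"
proof (cases "lform (l j) (h i) = 0")
  case True
  then show ?thesis
    by (auto simp: weight_def intro!: sum.cong)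
next
  case False
  have "(\<Sum>k | lform (l k) (h i) \<noteq> 0. (a(j := Suc (a j))) k) =
      (\<Sum>k | lform (l k) (h i) \<noteq> 0. (if k = j then 1 else 0) + a k)"
    by (intro sum.cong) auto
  with False show ?thesis
    by (simp add: weight_def sum.distrib)
qed

text \<open>The function lives on all of \<open>V\<close> but its degrees are bounded only inside
  the flat, so it stays admissible on smaller flats. The bound \<open>weight a\<close> is H a,
  because \<open>h i\<close> lies off the hyperplane of \<open>l j\<close> exactly when
  \<open>lform (l j) (h i) \<noteq> 0\<close>.\<close>

definition admissible :: "'n set \<Rightarrow> nat \<Rightarrow> ('n \<Rightarrow> nat) \<Rightarrow> (complex ^ 'r \<Rightarrow> complex) \<Rightarrow> bool"
  where "admissible B d a f \<longleftrightarrow> hpoly d f \<and>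
    (\<forall>i. h i \<in> flat B \<longrightarrow> deg_along (flat B) f (h i) (weight a i))"

lemma admissible_zero: "admissible B d a (\<lambda>x. 0)"
  by (simp add: admissible_def hpoly_zero deg_along_const)

lemma admissible_add:
  "admissible B d a f \<Longrightarrow> admissible B d a g \<Longrightarrow> admissible B d a (\<lambda>x. f x + g x)"
  by (auto simp: admissible_def intro: hpoly.add deg_along_add)

lemma admissible_scale: "admissible B d a f \<Longrightarrow> admissible B d a (\<lambda>x. c * f x)"
  by (auto simp: admissible_def intro: hpoly_scale deg_along_scale)

lemma admissible_diff:
  "admissible B d a f \<Longrightarrow> admissible B d a g \<Longrightarrow> admissible B d a (\<lambda>x. f x - g x)"
  using admissible_add[of B d a f "\<lambda>x. - 1 * g x"] admissible_scale[of B d a g "- 1"] by simp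

lemma admissible_insert: "admissible B d a f \<Longrightarrow> admissible (insert j B) d a f"
  by (auto simp: admissible_def flat_insert deg_along_def)

lemma admissible_mult:
  "admissible B d a f \<Longrightarrow>
    admissible B (Suc d) (a(j := Suc (a j))) (\<lambda>x. lform (l j) x * f x)"
  unfolding admissible_def weight_upd_Suc by (blast intro: hpoly.mult deg_along_lform_mult)

text \<open>Projection along \<open>v\<close> sends the flat into the smaller flat, where
  \<open>f\<close> vanishes, so \<open>hpoly_factor\<close> leaves only the multiple of the form.
  The degree bounds pass to the quotient by \<open>deg_along_lform_divide\<close>.\<close>

lemma admissible_factor:
  assumes f: "admissible B d (a(j := Suc (a j))) f" and j: "l j \<notin> vec.span (l ` B)"
    and vanish: "\<And>x. x \<in> flat (insert j B) \<Longrightarrow> f x = 0"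
  shows "\<exists>g. admissible B (d - 1) a g \<and> (d = 0 \<longrightarrow> g = (\<lambda>x. 0)) \<and>
    (\<forall>x\<in>flat B. f x = lform (l j) x * g x)"
proof -
  obtain v where v: "v \<in> flat B" "lform (l j) v = 1"
    using lform_separates[OF j] by blast
  obtain g where g: "hpoly (d - 1) g" "d = 0 \<Longrightarrow> g = (\<lambda>x. 0)"
    "\<And>x. f x = f (x - lform (l j) x *s v) + lform (l j) x * g x"
    using hpoly_factor[OF _ v(2), of d f] f unfolding admissible_def by blast
  have eq: "f x = lform (l j) x * g x" if x: "x \<in> flat B" for x
  proof -
    have "x - lform (l j) x *s v \<in> flat (insert j B)"
      using x v subspace_flat
      by (auto simp: flat_insert lform_diff_right lform_scale_right
          intro!: vec.subspace_diff vec.subspace_scale)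
    then have "f (x - lform (l j) x *s v) = 0"
      by (rule vanish)
    then show ?thesis
      using g(3)[of x] by (metis add_0)
  qed
  have "deg_along (flat B) g (h i) (weight a i)" if "h i \<in> flat B" for i
    using f that v unfolding admissible_def weight_upd_Suc
    by (intro deg_along_lform_divide[OF g(1) subspace_flat _ v(1) _ eq]) auto
  then have "admissible B (d - 1) a g"
    using g(1) by (simp add: admissible_def)
  then show ?thesis
    using g(2) eq by blast
qed

text \<open>All forms of positive multiplicity vanish on the flat, so every degree bound there is 0:
  \<open>f\<close> is constant along each line of the flat, and these lines span it.\<close>

lemma admissible_const_on_flat:
  assumes f: "admissible B d a f" and a: "\<And>j. a j > 0 \<Longrightarrow> l j \<in> vec.span (l ` B)"
    and y: "y \<in> flat B"
  shows "f y = f 0"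
proof -
  have along: "f (x + c *s h i) = f x" if i: "h i \<in> flat B" and x: "x \<in> flat B" for i x c
  proof -
    have "weight a i = 0"
      unfolding weight_def using a lform_span_eq_0[OF _ i] by fastforce
    then obtain p where p: "degree p = 0" "\<And>c. f (x + c *s h i) = poly p c"
      using f i x unfolding admissible_def deg_along_def by (metis le_zero_eq)
    obtain c0 where "p = [:c0:]"
      using p(1) degree_eq_zeroE by blast
    then show ?thesis
      using p(2)[of c] p(2)[of 0] by simp
  qed
  have "\<forall>x\<in>flat B. f (x + y) = f x"
    using flat_spanned_by_lines[OF y]
  proof (induction rule: vec.span_induct_alt)
    case base
    show ?case by simp
  next
    case (step c z y)
    then obtain i where i: "z = h i" "h i \<in> flat B" by blast
    show ?case
    proof
      fix x assume x: "x \<in> flat B"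
      then have "x + c *s z \<in> flat B"
        using i subspace_flat by (intro vec.subspace_add vec.subspace_scale) auto
      then have "f ((x + c *s z) + y) = f (x + c *s z)"
        using step.IH by blast
      then show "f (x + (c *s z + y)) = f x"
        using along[OF i(2) x] i(1) by (simp add: add.assoc)
    qed
  qed
  then show ?thesis
    using vec.subspace_0[OF subspace_flat] by (metis add_0)
qed

text \<open>The span of the products of \<open>d\<close> forms that use \<open>l j\<close> at most
  \<open>a j\<close> times. \<open>const\<close> accepts any \<open>a\<close> and so absorbs the
  multiplicity left over; \<open>zero\<close> covers the degrees above the sum of \<open>a\<close>,
  which the other rules cannot reach.\<close>

inductive lprod :: "nat \<Rightarrow> ('n \<Rightarrow> nat) \<Rightarrow> (complex ^ 'r \<Rightarrow> complex) \<Rightarrow> bool" where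
  zero: "lprod d a (\<lambda>x. 0)"
| const: "lprod 0 a (\<lambda>x. c)"
| mult: "lprod d a f \<Longrightarrow> lprod (Suc d) (a(j := Suc (a j))) (\<lambda>x. lform (l j) x * f x)"
| add: "lprod d a f \<Longrightarrow> lprod d a g \<Longrightarrow> lprod d a (\<lambda>x. f x + g x)"

lemma lprod_admissible: "lprod d a f \<Longrightarrow> admissible B d a f"
proof (induction rule: lprod.induct)
  case (const a c)
  then show ?case by (simp add: admissible_def hpoly.const deg_along_const)
qed (auto intro: admissible_zero admissible_mult admissible_add simp del: fun_upd_apply)

lemma sum_upd_Suc: "sum (a(j := Suc (a j))) UNIV = Suc (sum a (UNIV :: 'n set))" for a :: "'n \<Rightarrow> nat"
proof -
  have "sum (a(j := Suc (a j))) UNIV = (\<Sum>k\<in>UNIV. (if k = j then 1 else 0) + a k)"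
    by (intro sum.cong) auto
  then show ?thesis by (simp add: sum.distrib)
qed

lemma exists_upd_Suc: "a j > 0 \<Longrightarrow> \<exists>b. a = b(j := Suc (b j))" for a :: "'n \<Rightarrow> nat"
  by (intro exI[of _ "a(j := a j - 1)"]) auto

text \<open>Match \<open>f\<close> on the smaller flat by some \<open>p\<close>, divide the
  difference by \<open>l j\<close>, and treat the quotient inductively; each call either enlarges
  \<open>B\<close> or lowers \<open>a\<close>. The result gives extension from a flat to larger ones
  and, for \<open>B = {}\<close>, generation by products.\<close>

lemma admissible_eq_lprod:
  "admissible B d a f \<Longrightarrow> \<exists>p. lprod d a p \<and> (\<forall>x\<in>flat B. f x = p x)"
proof (induction "sum a UNIV + card (- B)" arbitrary: a B d f rule: less_induct)
  case less
  show ?case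
  proof (cases "\<exists>j. a j > 0 \<and> l j \<notin> vec.span (l ` B)")
    case True
    then obtain j where j: "a j > 0" "l j \<notin> vec.span (l ` B)" by blast
    obtain b where b: "a = b(j := Suc (b j))"
      using exists_upd_Suc j(1) by blast
    have "j \<notin> B"
      using j(2) vec.span_superset by blast
    then have "card (- insert j B) < card (- B)"
      by (intro psubset_card_mono) auto
    then obtain p where p: "lprod d a p" "\<And>x. x \<in> flat (insert j B) \<Longrightarrow> f x = p x"
      using less.hyps[of a "insert j B" d f] admissible_insert[OF less.prems] by auto
    \<comment> \<open>\<open>p\<close> was found on the smaller flat, but products of forms satisfy
      the bounds on every flat.\<close>
    have adm: "admissible B d (b(j := Suc (b j))) (\<lambda>x. f x - p x)"
      unfolding b[symmetric] using less.prems lprod_admissible[OF p(1)] by (rule admissible_diff)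
    have vanish: "f x - p x = 0" if "x \<in> flat (insert j B)" for x
      using p(2)[OF that] by simp
    obtain g where g: "admissible B (d - 1) b g" "d = 0 \<Longrightarrow> g = (\<lambda>x. 0)"
      "\<And>x. x \<in> flat B \<Longrightarrow> f x - p x = lform (l j) x * g x"
      using admissible_factor[OF adm j(2) vanish] by blast
    obtain q where q: "lprod (d - 1) b q" "\<And>x. x \<in> flat B \<Longrightarrow> g x = q x"
      using less.hyps[of b B "d - 1" g] g(1) sum_upd_Suc[of b j] b by auto
    show ?thesis
    proof (cases d)
      case 0
      then show ?thesis
        using p(1) g(2,3) by (intro exI[of _ p]) auto
    next
      case (Suc e)
      then have "lprod d a (\<lambda>x. p x + lform (l j) x * q x)"
        using p(1) lprod.mult[of e b q j] q(1) b by (intro lprod.add) auto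
      moreover have "f x = p x + lform (l j) x * q x" if "x \<in> flat B" for x
        using g(3)[OF that] q(2)[OF that] by (simp add: algebra_simps)
      ultimately show ?thesis by blast
    qed
  next
    case False
    then have const: "f x = f 0" if "x \<in> flat B" for x
      using admissible_const_on_flat[OF less.prems _ that] by blast
    show ?thesis
    proof (cases "d = 0")
      case True
      then show ?thesis
        using lprod.const const by blast
    next
      case nz: False
      then have "f 0 = 0"
        using less.prems hpoly_at_0 by (auto simp: admissible_def)
      then show ?thesis
        using lprod.zero const by metis
    qed
  qed
qed

end

section \<open>The rank generating function\<close>

context lines_arrangement
begin

definition rank :: "'n set \<Rightarrow> nat"
  where "rank B = vec.dim (l ` B)"

lemma rank_mono: "B \<subseteq> C \<Longrightarrow> rank B \<le> rank C"
  unfolding rank_def by (intro vec.dim_mono) (use vec.span_superset in blast)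

lemma rank_insert: "l j \<notin> vec.span (l ` B) \<Longrightarrow> rank (insert j B) = Suc (rank B)"
  by (simp add: rank_def vec.dim_insert)

lemma rank_Un_span:
  assumes "l ` E \<subseteq> vec.span (l ` B)"
  shows "rank (B \<union> E) = rank B"
  unfolding rank_def
proof (rule vec.span_eq_dim)
  have "vec.span (l ` (B \<union> E)) \<subseteq> vec.span (l ` B)"
    using assms by (intro vec.span_minimal) (auto simp: image_Un intro: vec.span_base)
  moreover have "vec.span (l ` B) \<subseteq> vec.span (l ` (B \<union> E))"
    by (intro vec.span_mono) auto
  ultimately show "vec.span (l ` (B \<union> E)) = vec.span (l ` B)" by blast
qed

text \<open>The closed form for the Hilbert series of the space on \<open>flat B\<close>, with
  \<open>q\<close> in place of the inverse of \<open>1 - t\<close>. The exponent of \<open>q\<close>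
  is the rank of \<open>E\<close> after contraction by \<open>B\<close>.\<close>

definition rank_gen :: "'a::comm_ring_1 \<Rightarrow> 'a \<Rightarrow> 'n set \<Rightarrow> ('n \<Rightarrow> nat) \<Rightarrow> 'a"
  where "rank_gen t q B a = (\<Sum>E\<in>UNIV. q ^ (rank (B \<union> E) - rank B) *
    ((\<Prod>e\<in>E. 1 - t ^ a e) * (\<Prod>e\<in>- E. t ^ a e)))"

text \<open>Sets \<open>E\<close> with an element of multiplicity 0 have weight 0, and all others
  leave the rank unchanged. What remains is the expansion of the product of
  \<open>(1 - t ^ a e) + t ^ a e\<close>.\<close>

lemma rank_gen_eq_1:
  assumes "\<And>j. a j > 0 \<Longrightarrow> l j \<in> vec.span (l ` B)"
  shows "rank_gen t q B a = 1"
proof -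
  have "q ^ (rank (B \<union> E) - rank B) * ((\<Prod>e\<in>E. 1 - t ^ a e) * (\<Prod>e\<in>- E. t ^ a e)) =
      (\<Prod>e\<in>E. 1 - t ^ a e) * (\<Prod>e\<in>- E. t ^ a e)" for E
  proof (cases "\<exists>e\<in>E. a e = 0")
    case True
    then obtain e where "e \<in> E" "a e = 0" by blast
    then have "(\<Prod>e\<in>E. 1 - t ^ a e) = 0"
      by (intro prod_zero bexI[of _ e]) auto
    then show ?thesis by simp
  next
    case False
    then have "rank (B \<union> E) = rank B"
      using assms by (intro rank_Un_span) auto
    then show ?thesis by simp
  qed
  then have "rank_gen t q B a = (\<Sum>E\<in>Pow UNIV. (\<Prod>e\<in>E. 1 - t ^ a e) * (\<Prod>e\<in>UNIV - E. t ^ a e))"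
    by (simp add: rank_gen_def Compl_eq_Diff_UNIV)
  also have "\<dots> = (\<Prod>e\<in>UNIV. (1 - t ^ a e) + t ^ a e)"
    by (rule prod_add[symmetric]) simp
  finally show ?thesis by simp
qed

lemma sum_sets_split:
  fixes j :: 'n
  shows "(\<Sum>E\<in>UNIV. F E) = (\<Sum>E | j \<notin> E. F E + F (insert j E))"
proof -
  have "(\<Sum>E\<in>UNIV. F E) = (\<Sum>E | j \<notin> E. F E) + (\<Sum>E | j \<in> E. F E)"
    by (subst sum.union_disjoint[symmetric]) (auto intro: sum.cong)
  also have "(\<Sum>E | j \<in> E. F E) = (\<Sum>E | j \<notin> E. F (insert j E))"
    by (rule sum.reindex_bij_witness[of _ "insert j" "\<lambda>E. E - {j}"]) (auto simp: insert_absorb)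
  finally show ?thesis
    by (simp add: sum.distrib)
qed

lemma rank_gen_split:
  "rank_gen t q B a = (\<Sum>E | j \<notin> E. ((\<Prod>e\<in>E. 1 - t ^ a e) * (\<Prod>e\<in>- insert j E. t ^ a e)) *
    (q ^ (rank (B \<union> E) - rank B) * t ^ a j + q ^ (rank (insert j B \<union> E) - rank B) * (1 - t ^ a j)))"
  unfolding rank_gen_def sum_sets_split[of _ j]
proof (rule sum.cong[OF refl])
  fix E assume E: "E \<in> {E. j \<notin> E}"
  have "- E = insert j (- insert j E)"
    using E by auto
  then have "(\<Prod>e\<in>- E. t ^ a e) = t ^ a j * (\<Prod>e\<in>- insert j E. t ^ a e)"
    by simp
  moreover have "(\<Prod>e\<in>insert j E. 1 - t ^ a e) = (1 - t ^ a j) * (\<Prod>e\<in>E. 1 - t ^ a e)"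
    using E by simp
  moreover have "B \<union> insert j E = insert j B \<union> E"
    by simp
  ultimately show "q ^ (rank (B \<union> E) - rank B) * ((\<Prod>e\<in>E. 1 - t ^ a e) * (\<Prod>e\<in>- E. t ^ a e)) +
      q ^ (rank (B \<union> insert j E) - rank B) *
        ((\<Prod>e\<in>insert j E. 1 - t ^ a e) * (\<Prod>e\<in>- insert j E. t ^ a e)) =
      ((\<Prod>e\<in>E. 1 - t ^ a e) * (\<Prod>e\<in>- insert j E. t ^ a e)) *
      (q ^ (rank (B \<union> E) - rank B) * t ^ a j + q ^ (rank (insert j B \<union> E) - rank B) * (1 - t ^ a j))"
    by (simp only:) (simp add: algebra_simps)
qed

text \<open>Holds term by term once \<open>E\<close> is paired with \<open>insert j E\<close>. After
  contraction by \<open>j\<close> both members of a pair have the same rank, so their weights for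
  \<open>j\<close> add up to 1; this rank is one lower than that of \<open>insert j E\<close>
  before, which \<open>q * (1 - t) = 1\<close> converts into the factor
  \<open>1 - t\<close>.\<close>

lemma rank_gen_rec:
  assumes q: "q * (1 - t) = 1" and j: "l j \<notin> vec.span (l ` B)"
  shows "rank_gen t q B (a(j := Suc (a j))) =
    t * rank_gen t q B a + rank_gen t q (insert j B) (a(j := Suc (a j)))"
proof -
  let ?a = "a(j := Suc (a j))"
  define w where "w E = (\<Prod>e\<in>E. 1 - t ^ a e) * (\<Prod>e\<in>- insert j E. t ^ a e)" for E
  have w: "(\<Prod>e\<in>E. 1 - t ^ ?a e) * (\<Prod>e\<in>- insert j E. t ^ ?a e) = w E" if "j \<notin> E" for E
  proof -
    have "(\<Prod>e\<in>E. 1 - t ^ ?a e) = (\<Prod>e\<in>E. 1 - t ^ a e)"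
      using that by (intro prod.cong) auto
    moreover have "(\<Prod>e\<in>- insert j E. t ^ ?a e) = (\<Prod>e\<in>- insert j E. t ^ a e)"
      by (intro prod.cong) auto
    ultimately show ?thesis by (simp add: w_def)
  qed
  have gen: "rank_gen t q C ?a = (\<Sum>E | j \<notin> E. w E * (q ^ (rank (C \<union> E) - rank C) * t ^ Suc (a j) +
      q ^ (rank (insert j C \<union> E) - rank C) * (1 - t ^ Suc (a j))))" for C
    unfolding rank_gen_split[of t q C ?a j] using w by (intro sum.cong) auto
  have "rank_gen t q B ?a = (\<Sum>E | j \<notin> E. w E * (q ^ (rank (B \<union> E) - rank B) * t ^ Suc (a j) +
      q ^ (rank (insert j B \<union> E) - rank B) * (1 - t ^ Suc (a j))))"
    by (rule gen)
  also have "\<dots> = (\<Sum>E | j \<notin> E. t * (w E * (q ^ (rank (B \<union> E) - rank B) * t ^ a j +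
      q ^ (rank (insert j B \<union> E) - rank B) * (1 - t ^ a j))) +
      w E * (q ^ (rank (insert j B \<union> E) - rank (insert j B)) * t ^ Suc (a j) +
        q ^ (rank (insert j (insert j B) \<union> E) - rank (insert j B)) * (1 - t ^ Suc (a j))))"
  proof (rule sum.cong[OF refl])
    fix E
    define n where "n = rank (insert j B \<union> E) - rank (insert j B)"
    have "rank (insert j B) \<le> rank (insert j B \<union> E)"
      by (rule rank_mono) blast
    then have rank_diff: "rank (insert j B \<union> E) - rank B = Suc n"
      using rank_insert[OF j] by (simp add: n_def)
    define X where "X = q ^ Suc n"
    have "X * (1 - t) = q ^ n"
      unfolding X_def by (simp only: power_Suc2 mult.assoc q mult_1_right)
    then have Z: "q ^ n = X - t * X"
      by (simp add: algebra_simps)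
    show "w E * (q ^ (rank (B \<union> E) - rank B) * t ^ Suc (a j) +
        q ^ (rank (insert j B \<union> E) - rank B) * (1 - t ^ Suc (a j))) =
      t * (w E * (q ^ (rank (B \<union> E) - rank B) * t ^ a j +
        q ^ (rank (insert j B \<union> E) - rank B) * (1 - t ^ a j))) +
      w E * (q ^ (rank (insert j B \<union> E) - rank (insert j B)) * t ^ Suc (a j) +
        q ^ (rank (insert j (insert j B) \<union> E) - rank (insert j B)) * (1 - t ^ Suc (a j)))"
      unfolding insert_absorb2 n_def[symmetric] rank_diff X_def[symmetric] power_Suc[of t]
      unfolding Z by (simp add: algebra_simps)
  qed
  also have "\<dots> = t * rank_gen t q B a + rank_gen t q (insert j B) ?a"
    unfolding sum.distrib sum_distrib_left[symmetric] rank_gen_split[of t q B a j] gen w_def ..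
  finally show ?thesis .
qed

section \<open>Dimensions by deletion and contraction\<close>

text \<open>Extension by zero keeps the functions on all flats in one vector space, with restriction
  as a linear endomorphism.\<close>

definition restr :: "'n set \<Rightarrow> (complex ^ 'r \<Rightarrow> complex) \<Rightarrow> complex ^ 'r \<Rightarrow> complex"
  where "restr B f = (\<lambda>x. if x \<in> flat B then f x else 0)"

definition cspace :: "'n set \<Rightarrow> nat \<Rightarrow> ('n \<Rightarrow> nat) \<Rightarrow> (complex ^ 'r \<Rightarrow> complex) set"
  where "cspace B d a = restr B ` {f. admissible B d a f}"

lemma restr_eq_iff: "restr B f = restr B g \<longleftrightarrow> (\<forall>x\<in>flat B. f x = g x)"
  by (auto simp: restr_def fun_eq_iff)

lemma restr_add: "restr B f + restr B g = restr B (\<lambda>x. f x + g x)"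
  by (auto simp: restr_def fun_eq_iff)

lemma restr_scale: "fun_scale c (restr B f) = restr B (\<lambda>x. c * f x)"
  by (auto simp: restr_def fun_scale_def fun_eq_iff)

lemma restr_zero: "restr B (\<lambda>x. 0) = 0"
  by (auto simp: restr_def fun_eq_iff)

lemma linear_restr: "Vector_Spaces.linear fun_scale fun_scale (restr B)"
  by (unfold_locales) (auto simp: restr_def fun_scale_def fun_eq_iff)

lemma linear_mult_fun: "Vector_Spaces.linear fun_scale fun_scale (\<lambda>f x. g x * f x)"
  by (unfold_locales) (auto simp: fun_scale_def fun_eq_iff algebra_simps)

lemma subspace_cspace: "fn.subspace (cspace B d a)"
  unfolding fn.subspace_def
proof (intro conjI ballI allI)
  show "0 \<in> cspace B d a"
    unfolding cspace_def using admissible_zero restr_zero by (metis imageI mem_Collect_eq)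
  fix f assume "f \<in> cspace B d a"
  then obtain f' where f: "f = restr B f'" "admissible B d a f'"
    by (auto simp: cspace_def)
  show "fun_scale c f \<in> cspace B d a" for c
    unfolding cspace_def f(1) restr_scale using admissible_scale f(2) by blast
  fix g assume "g \<in> cspace B d a"
  then obtain g' where g: "g = restr B g'" "admissible B d a g'"
    by (auto simp: cspace_def)
  show "f + g \<in> cspace B d a"
    unfolding cspace_def f(1) g(1) restr_add using admissible_add f(2) g(2) by blast
qed

text \<open>Onto, because a function on the smaller flat agrees there with a combination of products
  of forms, and that combination is admissible on the larger flat too.\<close>

lemma cspace_restr_insert: "restr (insert j B) ` cspace B d a = cspace (insert j B) d a"
proof -
  have rr: "restr (insert j B) (restr B f) = restr (insert j B) f" for f
    by (auto simp: restr_def flat_insert fun_eq_iff)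
  show ?thesis
  proof
    show "restr (insert j B) ` cspace B d a \<subseteq> cspace (insert j B) d a"
      by (auto simp: cspace_def rr intro: admissible_insert)
    show "cspace (insert j B) d a \<subseteq> restr (insert j B) ` cspace B d a"
    proof
      fix g assume "g \<in> cspace (insert j B) d a"
      then obtain f where f: "g = restr (insert j B) f" "admissible (insert j B) d a f"
        by (auto simp: cspace_def)
      obtain p where p: "lprod d a p" "\<forall>x\<in>flat (insert j B). f x = p x"
        using admissible_eq_lprod[OF f(2)] by blast
      have "g = restr (insert j B) (restr B p)"
        unfolding f(1) rr restr_eq_iff by (rule p(2))
      moreover have "restr B p \<in> cspace B d a"
        using lprod_admissible[OF p(1)] by (auto simp: cspace_def)
      ultimately show "g \<in> restr (insert j B) ` cspace B d a" by blast
    qed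
  qed
qed

text \<open>In degree 0 there are only constants, and the origin lies in both flats. The case is
  separate because there is no degree below 0 from which to multiply by the form.\<close>

lemma cspace_restr_kernel_0:
  "{f \<in> cspace B 0 a. restr (insert j B) f = 0} = {0}"
proof -
  have "f = 0" if f: "f \<in> cspace B 0 a" and f0: "restr (insert j B) f = 0" for f
  proof -
    obtain g where g: "f = restr B g" "admissible B 0 a g"
      using f by (auto simp: cspace_def)
    have "0 \<in> flat B" "0 \<in> flat (insert j B)"
      using subspace_flat vec.subspace_0 by blast+
    then have "g 0 = 0"
      using fun_cong[OF f0, of 0] by (simp add: g(1) restr_def)
    then have "g = (\<lambda>x. 0)"
      using g(2) hpoly_degree_0[of 0 g _ 0] by (auto simp: admissible_def)
    then show ?thesis
      by (simp add: g(1) restr_zero)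
  qed
  moreover have "0 \<in> cspace B 0 a"
    using fn.subspace_0[OF subspace_cspace] .
  moreover have "restr (insert j B) 0 = 0"
    by (simp add: restr_def fun_eq_iff)
  ultimately show ?thesis by blast
qed

lemma cspace_restr_kernel_Suc:
  assumes j: "l j \<notin> vec.span (l ` B)"
  shows "{f \<in> cspace B (Suc d) (a(j := Suc (a j))). restr (insert j B) f = 0} =
    (\<lambda>g x. lform (l j) x * g x) ` cspace B d a" (is "?K = ?I")
proof
  show "?K \<subseteq> ?I"
  proof
    fix f assume f: "f \<in> ?K"
    then obtain f' where f': "f = restr B f'" "admissible B (Suc d) (a(j := Suc (a j))) f'"
      by (auto simp: cspace_def)
    have "f' x = 0" if "x \<in> flat (insert j B)" for x
    proof -
      have "restr (insert j B) f x = 0"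
        using f by (simp add: zero_fun_def)
      with that show ?thesis
        by (simp add: f'(1) restr_def flat_insert)
    qed
    from admissible_factor[OF f'(2) j this] obtain g where
      g: "admissible B d a g" "\<forall>x\<in>flat B. f' x = lform (l j) x * g x" by auto
    have "f = (\<lambda>x. lform (l j) x * restr B g x)"
      using g(2) by (auto simp: f'(1) restr_def)
    then show "f \<in> ?I"
      using g(1) by (auto simp: cspace_def)
  qed
  show "?I \<subseteq> ?K"
  proof
    fix f assume "f \<in> ?I"
    then obtain g where g: "admissible B d a g" "f = (\<lambda>x. lform (l j) x * restr B g x)"
      by (auto simp: cspace_def)
    then have "f = restr B (\<lambda>x. lform (l j) x * g x)"
      by (auto simp: restr_def)
    moreover have "restr (insert j B) f = 0"
      by (auto simp: g(2) restr_def flat_insert)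
    ultimately show "f \<in> ?K"
      using admissible_mult[OF g(1)] by (auto simp: cspace_def)
  qed
qed

text \<open>The form is nonzero on a dense part of the flat, so it cancels by continuity.\<close>

lemma inj_on_lform_mult_cspace:
  assumes j: "l j \<notin> vec.span (l ` B)"
  shows "inj_on (\<lambda>g x. lform (l j) x * g x) (cspace B d a)"
proof (rule inj_onI)
  obtain v where v: "v \<in> flat B" "lform (l j) v = 1"
    using lform_separates[OF j] by blast
  fix f g assume "f \<in> cspace B d a" "g \<in> cspace B d a"
    and eq: "(\<lambda>x. lform (l j) x * f x) = (\<lambda>x. lform (l j) x * g x)"
  then obtain f' g' where f: "f = restr B f'" "admissible B d a f'"
    and g: "g = restr B g'" "admissible B d a g'"
    by (auto simp: cspace_def)
  have cont: "continuous_on UNIV (\<lambda>x. f' x - g' x)"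
    using f(2) g(2) unfolding admissible_def by (blast intro: continuous_on_diff continuous_on_hpoly)
  have zero: "f' y - g' y = 0" if "y \<in> flat B" "lform (l j) y \<noteq> 0" for y
    using fun_cong[OF eq, of y] that by (simp add: f(1) g(1) restr_def)
  have "f' x - g' x = 0" if x: "x \<in> flat B" for x
    using v by (intro continuous_zero_off_hyperplane[OF cont subspace_flat v(1) _ x zero]) auto
  then show "f = g"
    unfolding f(1) g(1) restr_eq_iff by simp
qed

lemma has_dim_cspace_loops:
  assumes a: "\<And>j. a j > 0 \<Longrightarrow> l j \<in> vec.span (l ` B)"
  shows "fn.has_dim (cspace B d a) (of_bool (d = 0))"
proof (cases "d = 0")
  case True
  have "cspace B d a = fn.span {restr B (\<lambda>x. 1)}"
  proof
    show "cspace B d a \<subseteq> fn.span {restr B (\<lambda>x. 1)}"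
    proof
      fix f assume "f \<in> cspace B d a"
      then obtain g where g: "f = restr B g" "admissible B d a g"
        by (auto simp: cspace_def)
      have "f = fun_scale (g 0) (restr B (\<lambda>x. 1))"
        unfolding g(1) restr_scale restr_eq_iff
        using admissible_const_on_flat[OF g(2) a] by simp
      then show "f \<in> fn.span {restr B (\<lambda>x. 1)}"
        by (simp add: fn.span_base fn.span_scale)
    qed
    have "admissible B d a (\<lambda>x. 1)"
      using True by (simp add: admissible_def hpoly.const deg_along_const)
    then show "fn.span {restr B (\<lambda>x. 1)} \<subseteq> cspace B d a"
      by (intro fn.span_minimal subspace_cspace) (auto simp: cspace_def)
  qed
  moreover have "restr B (\<lambda>x. 1) \<noteq> 0"
  proof
    assume "restr B (\<lambda>x. 1) = 0"
    then have "restr B (\<lambda>x. 1) 0 = 0" by (simp add: zero_fun_def)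
    then show False
      using vec.subspace_0[OF subspace_flat, of B] by (simp add: restr_def)
  qed
  ultimately show ?thesis
    using True unfolding fn.has_dim_def
    by (intro exI[of _ "{restr B (\<lambda>x. 1)}"]) simp
next
  case False
  have "f = 0" if f: "f \<in> cspace B d a" for f
  proof -
    obtain g where g: "f = restr B g" "admissible B d a g"
      using f by (auto simp: cspace_def)
    have "g 0 = 0"
      using g(2) False hpoly_at_0 by (auto simp: admissible_def)
    then have "restr B g = restr B (\<lambda>x. 0)"
      unfolding restr_eq_iff using admissible_const_on_flat[OF g(2) a] by simp
    then show ?thesis
      by (simp add: g(1) restr_zero)
  qed
  then have "cspace B d a = {0}"
    using fn.subspace_0[OF subspace_cspace] by blast
  with False show ?thesis
    using fn.has_dim_0 by simp
qed

text \<open>Partial sums replace the series, so the identity makes sense in any commutative ring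
  where \<open>q\<close> inverts \<open>1 - t\<close>. They are already stable at the sum of
  \<open>a\<close>, the largest degree of a product of forms.\<close>

lemma cspace_hilbert_series:
  fixes t q :: "'a::comm_ring_1"
  assumes q: "q * (1 - t) = 1"
  shows "\<exists>N. (\<forall>d. fn.has_dim (cspace B d a) (N d)) \<and>
    (\<forall>M \<ge> sum a UNIV. (\<Sum>d\<le>M. of_nat (N d) * t ^ d) = rank_gen t q B a)"
proof (induction "sum a UNIV + card (- B)" arbitrary: a B rule: less_induct)
  case less
  show ?case
  proof (cases "\<exists>j. a j > 0 \<and> l j \<notin> vec.span (l ` B)")
    case True
    then obtain j where j: "a j > 0" "l j \<notin> vec.span (l ` B)" by blast
    obtain b where b: "a = b(j := Suc (b j))"
      using exists_upd_Suc j(1) by blast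
    have sum_a: "sum a UNIV = Suc (sum b UNIV)"
      unfolding b by (rule sum_upd_Suc)
    have "j \<notin> B"
      using j(2) vec.span_superset by blast
    then have "card (- insert j B) < card (- B)"
      by (intro psubset_card_mono) auto
    then obtain N2 where N2: "\<And>d. fn.has_dim (cspace (insert j B) d a) (N2 d)"
      "\<And>M. M \<ge> sum a UNIV \<Longrightarrow> (\<Sum>d\<le>M. of_nat (N2 d) * t ^ d) = rank_gen t q (insert j B) a"
      using less[of a "insert j B"] by auto
    obtain N1 where N1: "\<And>d. fn.has_dim (cspace B d b) (N1 d)"
      "\<And>M. M \<ge> sum b UNIV \<Longrightarrow> (\<Sum>d\<le>M. of_nat (N1 d) * t ^ d) = rank_gen t q B b"
      using less[of b B] sum_a by auto
    \<comment> \<open>Kernel plus image: the kernel in degree \<open>Suc e\<close> is a copy of the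
      space for \<open>b\<close> in degree \<open>e\<close>, shifted by multiplication with
      \<open>l j\<close>.\<close>
    define N where "N d = (case d of 0 \<Rightarrow> 0 | Suc e \<Rightarrow> N1 e) + N2 d" for d
    have "fn.has_dim (cspace B d a) (N d)" for d
      unfolding N_def
    proof (rule fn_pair.has_dim_kernel_image[OF linear_restr subspace_cspace])
      show "fn.has_dim (restr (insert j B) ` cspace B d a) (N2 d)"
        unfolding cspace_restr_insert by (rule N2(1))
      show "fn.has_dim {v \<in> cspace B d a. restr (insert j B) v = 0} (case d of 0 \<Rightarrow> 0 | Suc e \<Rightarrow> N1 e)"
      proof (cases d)
        case 0
        then show ?thesis
          using cspace_restr_kernel_0 fn.has_dim_0 by simp
      next
        case (Suc e)
        have "fn.has_dim ((\<lambda>g x. lform (l j) x * g x) ` cspace B e b) (N1 e)"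
          by (rule fn_pair.has_dim_image[OF linear_mult_fun N1(1) inj_on_lform_mult_cspace[OF j(2)]])
        then show ?thesis
          unfolding Suc b cspace_restr_kernel_Suc[OF j(2)] by simp
      qed
    qed
    moreover have "(\<Sum>d\<le>M. of_nat (N d) * t ^ d) = rank_gen t q B a" if M: "M \<ge> sum a UNIV" for M
    proof -
      \<comment> \<open>The shift splits off one factor \<open>t\<close> and lowers the cutoff by
        one, which matches the sum of \<open>b\<close> being one less than that of
        \<open>a\<close>.\<close>
      obtain M' where M': "M = Suc M'" "M' \<ge> sum b UNIV"
        using M sum_a by (cases M) auto
      have "(\<Sum>d\<le>M. of_nat (N d) * t ^ d) =
          (\<Sum>d\<le>M. of_nat (case d of 0 \<Rightarrow> 0 | Suc e \<Rightarrow> N1 e) * t ^ d) + (\<Sum>d\<le>M. of_nat (N2 d) * t ^ d)"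
        by (simp add: N_def distrib_right sum.distrib)
      also have "(\<Sum>d\<le>M. of_nat (case d of 0 \<Rightarrow> 0 | Suc e \<Rightarrow> N1 e) * t ^ d) =
          t * (\<Sum>d\<le>M'. of_nat (N1 d) * t ^ d)"
        unfolding M'(1) sum.atMost_Suc_shift by (simp add: sum_distrib_left mult_ac)
      finally show ?thesis
        using N1(2)[OF M'(2)] N2(2)[OF M] rank_gen_rec[OF q j(2), of b] b by simp
    qed
    ultimately show ?thesis by blast
  next
    case False
    then have loops: "l j \<in> vec.span (l ` B)" if "a j > 0" for j
      using that by blast
    have "(\<Sum>d\<le>M. of_nat (of_bool (d = 0)) * t ^ d) = 1" for M
      by (simp add: sum.atMost_shift)
    then show ?thesis
      using has_dim_cspace_loops[OF loops] rank_gen_eq_1[OF loops]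
      by (intro exI[of _ "\<lambda>d. of_bool (d = 0)"]) auto
  qed
qed

end

section \<open>Evaluation of polynomials\<close>

definition monom_eval :: "('v::finite \<Rightarrow> complex) \<Rightarrow> ('v \<Rightarrow>\<^sub>0 nat) \<Rightarrow> complex"
  where "monom_eval s w = (\<Prod>x\<in>UNIV. s x ^ Poly_Mapping.lookup w x)"

definition cpoly_eval :: "('v::finite \<Rightarrow> complex) \<Rightarrow> 'v cpoly \<Rightarrow> complex"
  where "cpoly_eval s p = (\<Sum>w\<in>Poly_Mapping.keys p. Poly_Mapping.lookup p w * monom_eval s w)"

lemma monom_eval_add: "monom_eval s (v + w) = monom_eval s v * monom_eval s w"
  by (simp add: monom_eval_def lookup_add power_add prod.distrib)

lemma cpoly_eval_superset:
  assumes "finite W" "Poly_Mapping.keys p \<subseteq> W"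
  shows "cpoly_eval s p = (\<Sum>w\<in>W. Poly_Mapping.lookup p w * monom_eval s w)"
  unfolding cpoly_eval_def using assms
  by (intro sum.mono_neutral_left) (auto simp: in_keys_iff)

lemma cpoly_eval_add: "cpoly_eval s (p + q) = cpoly_eval s p + cpoly_eval s q"
proof -
  let ?W = "Poly_Mapping.keys p \<union> Poly_Mapping.keys q"
  have "cpoly_eval s (p + q) = (\<Sum>w\<in>?W. Poly_Mapping.lookup (p + q) w * monom_eval s w)"
    by (intro cpoly_eval_superset Poly_Mapping.keys_add) auto
  then show ?thesis
    by (simp add: lookup_add distrib_right sum.distrib cpoly_eval_superset[of ?W])
qed

lemma cpoly_eval_zero [simp]: "cpoly_eval s 0 = 0"
  by (simp add: cpoly_eval_def)

lemma cpoly_eval_sum: "cpoly_eval s (sum f A) = (\<Sum>x\<in>A. cpoly_eval s (f x))"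
  by (induction A rule: infinite_finite_induct) (auto simp: cpoly_eval_add)

lemma cpoly_eval_single: "cpoly_eval s (Poly_Mapping.single w c) = c * monom_eval s w"
  by (simp add: cpoly_eval_def)

lemma cpoly_eq_sum_single:
  "p = (\<Sum>w\<in>Poly_Mapping.keys p. Poly_Mapping.single w (Poly_Mapping.lookup p w))"
proof (rule poly_mapping_eqI)
  fix v
  have "(\<Sum>w\<in>Poly_Mapping.keys p. Poly_Mapping.lookup (Poly_Mapping.single w (Poly_Mapping.lookup p w)) v) =
      (\<Sum>w\<in>Poly_Mapping.keys p. if w = v then Poly_Mapping.lookup p v else 0)"
    by (intro sum.cong) (auto simp: lookup_single when_def)
  then show "Poly_Mapping.lookup p v =
      Poly_Mapping.lookup (\<Sum>w\<in>Poly_Mapping.keys p. Poly_Mapping.single w (Poly_Mapping.lookup p w)) v"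
    by (simp add: lookup_sum in_keys_iff)
qed

lemma cpoly_eval_mult: "cpoly_eval s (p * q) = cpoly_eval s p * cpoly_eval s q"
proof -
  let ?s = "\<lambda>p w. Poly_Mapping.single w (Poly_Mapping.lookup p w)"
  have "p * q = (\<Sum>v\<in>Poly_Mapping.keys p. ?s p v) * (\<Sum>w\<in>Poly_Mapping.keys q. ?s q w)"
    using cpoly_eq_sum_single[of p] cpoly_eq_sum_single[of q] by simp
  also have "\<dots> = (\<Sum>v\<in>Poly_Mapping.keys p. \<Sum>w\<in>Poly_Mapping.keys q.
      Poly_Mapping.single (v + w) (Poly_Mapping.lookup p v * Poly_Mapping.lookup q w))"
    by (simp add: sum_product mult_single)
  finally have "cpoly_eval s (p * q) = (\<Sum>v\<in>Poly_Mapping.keys p. \<Sum>w\<in>Poly_Mapping.keys q.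
      (Poly_Mapping.lookup p v * monom_eval s v) * (Poly_Mapping.lookup q w * monom_eval s w))"
    by (simp add: cpoly_eval_sum cpoly_eval_single monom_eval_add mult_ac)
  then show ?thesis
    by (simp add: cpoly_eval_def sum_product)
qed

lemma cpoly_eval_const [simp]: "cpoly_eval s (cpoly_const c) = c"
  by (simp add: cpoly_const_def cpoly_eval_single monom_eval_def)

lemma cpoly_eval_one [simp]: "cpoly_eval s 1 = 1"
  using cpoly_eval_const[of s 1] by (simp add: cpoly_const_def)

lemma cpoly_eval_var [simp]: "cpoly_eval s (cpoly_var x) = s x"
proof -
  have "monom_eval s (Poly_Mapping.single x 1) = (\<Prod>y\<in>UNIV. if y = x then s y else 1)"
    unfolding monom_eval_def by (intro prod.cong) (auto simp: lookup_single when_def)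
  then show ?thesis
    by (simp add: cpoly_var_def cpoly_eval_single)
qed

lemma cpoly_eval_prod: "cpoly_eval s (prod f A) = (\<Prod>x\<in>A. cpoly_eval s (f x))"
  by (induction A rule: infinite_finite_induct) (auto simp: cpoly_eval_mult)

lemma cpoly_eval_power: "cpoly_eval s (p ^ n) = cpoly_eval s p ^ n"
  by (induction n) (auto simp: cpoly_eval_mult)

lemma cpoly_eval_subst: "cpoly_eval s (cpoly_subst f p) = cpoly_eval (\<lambda>x. cpoly_eval s (f x)) p"
proof -
  have "(\<Prod>x\<in>Poly_Mapping.keys w. cpoly_eval s (f x) ^ Poly_Mapping.lookup w x) =
      monom_eval (\<lambda>x. cpoly_eval s (f x)) w" for w
    unfolding monom_eval_def by (rule prod.mono_neutral_left) (auto simp: in_keys_iff)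
  then show ?thesis
    by (simp add: cpoly_subst_def cpoly_eval_sum cpoly_eval_mult cpoly_eval_prod cpoly_eval_power
        cpoly_eval_def[of _ p])
qed

text \<open>
  Distinct monomials are distinct multiplicative characters, so this is Dedekind's argument:
  doubling one coordinate that separates two exponents eliminates a term.
\<close>

lemma monomials_independent:
  fixes e :: "'w \<Rightarrow> 'v::finite \<Rightarrow> nat" and c :: "'w \<Rightarrow> complex"
  assumes "finite W" "inj_on e W" "\<And>s. (\<Sum>w\<in>W. c w * (\<Prod>x\<in>UNIV. s x ^ e w x)) = 0" "w \<in> W"
  shows "c w = 0"
  using assms
proof (induction "card W" arbitrary: W c w rule: less_induct)
  case less
  show ?case
  proof (cases "W = {w}")
    case True
    then show ?thesis
      using less.prems(3)[of "\<lambda>x. 1"] by simp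
  next
    case False
    then obtain v where v: "v \<in> W" "v \<noteq> w"
      using less.prems(4) by blast
    then have "e v \<noteq> e w"
      using less.prems(2,4) by (auto dest: inj_onD)
    then obtain y where y: "e v y \<noteq> e w y" by blast
    let ?\<chi> = "\<lambda>s w. \<Prod>x\<in>UNIV. s x ^ e w x"
    have double: "?\<chi> (s(y := 2 * s y)) u = 2 ^ e u y * ?\<chi> s u" for s :: "'v \<Rightarrow> complex" and u
    proof -
      have "?\<chi> (s(y := 2 * s y)) u = (\<Prod>x\<in>UNIV. (if x = y then 2 ^ e u x else 1) * s x ^ e u x)"
        by (intro prod.cong) (auto simp: power_mult_distrib)
      then show ?thesis
        by (simp add: prod.distrib)
    qed
    have elim: "(\<Sum>u\<in>W - {v}. (c u * (2 ^ e u y - 2 ^ e v y)) * ?\<chi> s u) = 0" for s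
    proof -
      have "(\<Sum>u\<in>W. (c u * (2 ^ e u y - 2 ^ e v y)) * ?\<chi> s u) =
          (\<Sum>u\<in>W. c u * ?\<chi> (s(y := 2 * s y)) u) - 2 ^ e v y * (\<Sum>u\<in>W. c u * ?\<chi> s u)"
        unfolding double by (simp add: algebra_simps sum_subtractf sum_distrib_left)
      then show ?thesis
        using less.prems(1,3) v(1) by (simp add: sum.remove[of W v] del: fun_upd_apply)
    qed
    have "c w * (2 ^ e w y - 2 ^ e v y) = 0"
    proof (rule less.hyps[of "W - {v}" "\<lambda>u. c u * (2 ^ e u y - 2 ^ e v y)" w])
      show "card (W - {v}) < card W"
        using less.prems(1) v(1) by (rule card_Diff1_less)
      show "inj_on e (W - {v})"
        using less.prems(2) by (rule inj_on_subset) blast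
      show "w \<in> W - {v}"
        using less.prems(4) v by blast
    qed (use less.prems(1) elim in simp_all)
    moreover have "(2 :: complex) ^ e w y \<noteq> 2 ^ e v y"
    proof
      assume "(2 :: complex) ^ e w y = 2 ^ e v y"
      then have "cmod (2 ^ e w y) = cmod (2 ^ e v y)" by simp
      then have "(2 :: real) ^ e w y = 2 ^ e v y" by (simp add: norm_power)
      with y show False by simp
    qed
    ultimately show ?thesis by simp
  qed
qed

lemma cpoly_eval_inject:
  assumes "\<And>s. cpoly_eval s p = cpoly_eval s q"
  shows "p = q"
proof (rule poly_mapping_eqI)
  fix w
  let ?W = "insert w (Poly_Mapping.keys p \<union> Poly_Mapping.keys q)"
  let ?c = "\<lambda>w. Poly_Mapping.lookup p w - Poly_Mapping.lookup q w"
  have "?c w = 0"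
  proof (rule monomials_independent[where W = ?W and e = Poly_Mapping.lookup])
    show "inj_on Poly_Mapping.lookup ?W"
      by (simp add: inj_on_def)
    show "(\<Sum>w\<in>?W. ?c w * (\<Prod>x\<in>UNIV. s x ^ Poly_Mapping.lookup w x)) = 0" for s
      using assms[of s] cpoly_eval_superset[of ?W p s] cpoly_eval_superset[of ?W q s]
      by (simp add: monom_eval_def left_diff_distrib sum_subtractf subset_insertI2)
  qed auto
  then show "Poly_Mapping.lookup p w = Poly_Mapping.lookup q w" by simp
qed

section \<open>The grading of the polynomial ring\<close>

lemma UNIV_rvar: "UNIV = range SVar \<union> range TVar"
proof -
  have "x \<in> range SVar \<union> range TVar" for x :: "'a rvar"
    by (cases x) auto
  then show ?thesis by blast
qed

instance rvar :: (finite) finite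
  by standard (simp add: UNIV_rvar)

lemma prod_rvar:
  "(\<Prod>x\<in>UNIV. f x) = (\<Prod>i\<in>UNIV. f (SVar i)) * (\<Prod>i\<in>UNIV. f (TVar (i :: 'm::finite)))"
proof -
  have "(\<Prod>x\<in>UNIV. f x) = (\<Prod>x\<in>range SVar. f x) * (\<Prod>x\<in>range TVar. f x)"
    unfolding UNIV_rvar by (rule prod.union_disjoint) auto
  then show ?thesis
    by (simp add: prod.reindex inj_def)
qed

lemma sum_rvar:
  "(\<Sum>x\<in>UNIV. f x) = (\<Sum>i\<in>UNIV. f (SVar i)) + (\<Sum>i\<in>UNIV. f (TVar (i :: 'm::finite)))"
proof -
  have "(\<Sum>x\<in>UNIV. f x) = (\<Sum>x\<in>range SVar. f x) + (\<Sum>x\<in>range TVar. f x)"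
    unfolding UNIV_rvar by (rule sum.union_disjoint) auto
  then show ?thesis
    by (simp add: sum.reindex inj_def)
qed

lemma monom_degree_UNIV:
  fixes w :: "'m::finite rvar \<Rightarrow>\<^sub>0 nat"
  shows "monom_degree w k = (\<Sum>x\<in>UNIV. Poly_Mapping.lookup w x * var_degree x k)"
  unfolding monom_degree_def by (rule sum.mono_neutral_left) (auto simp: in_keys_iff)

lemma monom_degree_None:
  fixes w :: "'m::finite rvar \<Rightarrow>\<^sub>0 nat"
  shows "monom_degree w None = (\<Sum>i\<in>UNIV. Poly_Mapping.lookup w (TVar i))"
  by (simp add: monom_degree_UNIV sum_rvar)

lemma monom_degree_Some:
  fixes w :: "'m::finite rvar \<Rightarrow>\<^sub>0 nat"
  shows "monom_degree w (Some i) = Poly_Mapping.lookup w (SVar i) + Poly_Mapping.lookup w (TVar i)"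
  by (simp add: monom_degree_UNIV sum_rvar of_bool_def if_distrib cong: if_cong)

lemma monom_degree_add:
  fixes v w :: "'m::finite rvar \<Rightarrow>\<^sub>0 nat"
  shows "monom_degree (v + w) = (\<lambda>k. monom_degree v k + monom_degree w k)"
  by (simp add: monom_degree_UNIV lookup_add distrib_right sum.distrib fun_eq_iff)

definition homogeneous :: "('m option \<Rightarrow> nat) \<Rightarrow> 'm rvar cpoly \<Rightarrow> bool"
  where "homogeneous D p \<longleftrightarrow> (\<forall>w\<in>Poly_Mapping.keys p. monom_degree w = D)"

lemma homogeneous_zero: "homogeneous D 0"
  by (simp add: homogeneous_def)

lemma homogeneous_cong: "homogeneous D p \<Longrightarrow> (\<And>k. D k = E k) \<Longrightarrow> homogeneous E p"
  by (simp add: fun_eq_iff homogeneous_def)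

lemma homogeneous_add: "homogeneous D p \<Longrightarrow> homogeneous D q \<Longrightarrow> homogeneous D (p + q)"
  using Poly_Mapping.keys_add[of p q] by (auto simp: homogeneous_def)

lemma homogeneous_sum: "(\<And>x. x \<in> A \<Longrightarrow> homogeneous D (f x)) \<Longrightarrow> homogeneous D (sum f A)"
  by (induction A rule: infinite_finite_induct) (auto intro: homogeneous_zero homogeneous_add)

lemma homogeneous_mult:
  fixes p q :: "'m::finite rvar cpoly"
  assumes "homogeneous D p" "homogeneous E q"
  shows "homogeneous (\<lambda>k. D k + E k) (p * q)"
  using assms Poly_Mapping.keys_mult[of p q] by (fastforce simp: homogeneous_def monom_degree_add)

lemma homogeneous_const: "homogeneous (\<lambda>k. 0) (cpoly_const c)"
  by (auto simp: homogeneous_def cpoly_const_def monom_degree_def fun_eq_iff)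

lemma homogeneous_var: "homogeneous (var_degree x) (cpoly_var x)"
  by (auto simp: homogeneous_def cpoly_var_def monom_degree_def fun_eq_iff)

lemma homogeneous_prod:
  fixes f :: "'i \<Rightarrow> 'm::finite rvar cpoly"
  assumes "\<And>x. x \<in> A \<Longrightarrow> homogeneous (D x) (f x)"
  shows "homogeneous (\<lambda>k. \<Sum>x\<in>A. D x k) (prod f A)"
  using assms
proof (induction A rule: infinite_finite_induct)
  case (insert x A)
  then show ?case
    using homogeneous_mult[of "D x" "f x" "\<lambda>k. \<Sum>x\<in>A. D x k" "prod f A"] by simp
qed (use homogeneous_const[of 1] in \<open>simp_all add: cpoly_const_def\<close>)

lemma homogeneous_power:
  fixes p :: "'m::finite rvar cpoly"
  assumes "homogeneous D p"
  shows "homogeneous (\<lambda>k. n * D k) (p ^ n)"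
  using homogeneous_prod[of "{..<n}" "\<lambda>_. D" "\<lambda>_. p"] assms by simp

section \<open>Invariants as polynomial functions\<close>

lemma hpoly_mult: "hpoly d f \<Longrightarrow> hpoly e g \<Longrightarrow> hpoly (d + e) (\<lambda>x. f x * g x)"
proof (induction rule: hpoly.induct)
  case (const c)
  then show ?case by (simp add: hpoly_scale)
next
  case (mult d f m)
  then have "hpoly (Suc (d + e)) (\<lambda>x. lform m x * (f x * g x))"
    by (intro hpoly.mult)
  then show ?case by (simp add: mult.assoc)
next
  case (add d f f')
  then show ?case by (simp add: distrib_right hpoly.add)
qed

lemma hpoly_power: "hpoly d f \<Longrightarrow> hpoly (n * d) (\<lambda>x. f x ^ n)"
  by (induction n) (auto intro: hpoly.const hpoly_mult)

lemma hpoly_prod: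
  assumes "\<And>i. i \<in> A \<Longrightarrow> hpoly (d i) (f i)"
  shows "hpoly (\<Sum>i\<in>A. d i) (\<lambda>x. \<Prod>i\<in>A. f i x)"
  using assms by (induction A rule: infinite_finite_induct) (auto intro: hpoly.const hpoly_mult)

lemma hpoly_sum:
  assumes "\<And>i. i \<in> A \<Longrightarrow> hpoly d (f i)"
  shows "hpoly d (\<lambda>x. \<Sum>i\<in>A. f i x)"
  using assms by (induction A rule: infinite_finite_induct) (auto intro: hpoly_zero hpoly.add)

definition rpoint :: "('m \<Rightarrow> complex) \<Rightarrow> ('m \<Rightarrow> complex) \<Rightarrow> 'm rvar \<Rightarrow> complex"
  where "rpoint s t x = (case x of SVar i \<Rightarrow> s i | TVar i \<Rightarrow> t i)"

lemma rpoint_simps [simp]: "rpoint s t (SVar i) = s i" "rpoint s t (TVar i) = t i"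
  by (simp_all add: rpoint_def)

lemma rpoint_surj: "s = rpoint (\<lambda>i. s (SVar i)) (\<lambda>i. s (TVar i))"
  by (auto simp: rpoint_def split: rvar.split)

lemma monom_eval_rpoint_1:
  "monom_eval (rpoint (\<lambda>i. 1) t) w = (\<Prod>i\<in>UNIV. t i ^ Poly_Mapping.lookup w (TVar (i :: 'm::finite)))"
  by (simp add: monom_eval_def prod_rvar)

lemma cpoly_eval_shift_action:
  "cpoly_eval (rpoint s t) (shift_action c p) = cpoly_eval (rpoint s (\<lambda>i. t i + c $ i * s i)) p"
  unfolding shift_action_def cpoly_eval_subst
  by (intro arg_cong[of _ _ "\<lambda>s. cpoly_eval s p"])
    (auto simp: fun_eq_iff rpoint_def cpoly_eval_add cpoly_eval_mult split: rvar.split)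

text \<open>Complex polynomials are determined by their values, so invariance can be tested
  pointwise, and closure under sums and products becomes immediate.\<close>

lemma invariant_ring_iff:
  fixes h :: "'m::finite \<Rightarrow> complex ^ 'r"
  shows "p \<in> invariant_ring h \<longleftrightarrow> (\<forall>c\<in>relations_group h. \<forall>s t.
    cpoly_eval (rpoint s (\<lambda>i. t i + c $ i * s i)) p = cpoly_eval (rpoint s t) p)"
proof -
  have "shift_action c p = p \<longleftrightarrow>
      (\<forall>s t. cpoly_eval (rpoint s t) (shift_action c p) = cpoly_eval (rpoint s t) p)" for c
  proof
    assume eq: "\<forall>s t. cpoly_eval (rpoint s t) (shift_action c p) = cpoly_eval (rpoint s t) p"
    show "shift_action c p = p"
    proof (rule cpoly_eval_inject)
      fix s :: "'m rvar \<Rightarrow> complex"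
      show "cpoly_eval s (shift_action c p) = cpoly_eval s p"
        using eq rpoint_surj[of s] by metis
    qed
  qed simp
  then show ?thesis
    unfolding invariant_ring_def cpoly_eval_shift_action by simp
qed

context lines_arrangement
begin

definition degree_of :: "nat \<Rightarrow> ('n \<Rightarrow> nat) \<Rightarrow> 'm option \<Rightarrow> nat"
  where "degree_of d a = case_option d (weight a)"

definition invariants :: "nat \<Rightarrow> ('n \<Rightarrow> nat) \<Rightarrow> 'm rvar cpoly set"
  where "invariants d a = {p \<in> invariant_ring h. homogeneous (degree_of d a) p}"

lemma invariants_zero: "0 \<in> invariants d a"
  by (simp add: invariants_def invariant_ring_iff homogeneous_zero)

lemma invariants_add: "p \<in> invariants d a \<Longrightarrow> q \<in> invariants d a \<Longrightarrow> p + q \<in> invariants d a"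
  by (simp add: invariants_def invariant_ring_iff cpoly_eval_add homogeneous_add)

lemma invariants_scale: "p \<in> invariants d a \<Longrightarrow> cpoly_scale c p \<in> invariants d a"
  using homogeneous_mult[OF homogeneous_const, of "degree_of d a" p c]
  by (simp add: invariants_def invariant_ring_iff cpoly_eval_mult cpoly_scale_def)

lemma subspace_invariants: "cpoly.subspace (invariants d a)"
  by (auto simp: cpoly.subspace_def intro: invariants_zero invariants_add invariants_scale)

text \<open>A linear section of \<open>t \<mapsto> \<Sum>i. t i *s h i\<close>, available because
  the lines span \<open>V\<close>. Linearity is what will make \<open>to_fun p\<close> a polynomial
  function.\<close>

lemma coordinates_exist: "\<exists>T. \<forall>x. (\<Sum>i\<in>UNIV. lform (T i) x *s h i) = x"
proof -
  have "\<exists>c. (\<Sum>i\<in>UNIV. c i *s h i) = x" for x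
  proof -
    have "x \<in> vec.span (range h)"
    proof -
      have "x \<in> flat {}" by (simp add: flat_def)
      then have "x \<in> vec.span {h i |i. h i \<in> flat {}}"
        by (rule flat_spanned_by_lines)
      moreover have "{h i |i. h i \<in> flat {}} \<subseteq> range h" by blast
      ultimately show ?thesis
        using vec.span_mono by blast
    qed
    then show ?thesis
    proof (induction rule: vec.span_induct_alt)
      case base
      show ?case by (intro exI[of _ "\<lambda>i. 0"]) simp
    next
      case (step b z y)
      then obtain k c where "z = h k" "(\<Sum>i\<in>UNIV. c i *s h i) = y" by blast
      moreover have "(\<Sum>i\<in>UNIV. (if i = k then b else 0) *s h i) = b *s h k"
        by (simp add: if_distrib[of "\<lambda>u. u *s _"] cong: if_cong)
      ultimately have "(\<Sum>i\<in>UNIV. ((if i = k then b else 0) + c i) *s h i) = b *s z + y"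
        by (simp add: vec.scale_left_distrib sum.distrib)
      then show ?case by (intro exI[of _ "\<lambda>i. (if i = k then b else 0) + c i"])
    qed
  qed
  then obtain c where c: "\<And>x. (\<Sum>i\<in>UNIV. c x i *s h i) = x" by metis
  \<comment> \<open>The pointwise choice \<open>c\<close> need not be linear; only its values on the
    standard basis are kept and extended linearly.\<close>
  define T :: "'m \<Rightarrow> complex ^ 'r" where "T i = (\<chi> k. c (axis k 1) i)" for i
  have "(\<Sum>i\<in>UNIV. lform (T i) x *s h i) = x" for x
  proof -
    have "(\<Sum>i\<in>UNIV. lform (T i) x *s h i) =
        (\<Sum>i\<in>UNIV. \<Sum>k\<in>UNIV. x $ k *s (c (axis k 1) i *s h i))"
      by (simp add: lform_def T_def vec.scale_sum_left mult.commute)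
    also have "\<dots> = (\<Sum>k\<in>UNIV. x $ k *s (\<Sum>i\<in>UNIV. c (axis k 1) i *s h i))"
      unfolding vec.scale_sum_right by (rule sum.swap)
    also have "\<dots> = x"
      by (simp add: c basis_expansion)
    finally show ?thesis .
  qed
  then show ?thesis by blast
qed

definition coord :: "'m \<Rightarrow> complex ^ 'r"
  where "coord = (SOME T. \<forall>x. (\<Sum>i\<in>UNIV. lform (T i) x *s h i) = x)"

lemma sum_coord: "(\<Sum>i\<in>UNIV. lform (coord i) x *s h i) = x"
  using someI_ex[OF coordinates_exist] unfolding coord_def by blast

text \<open>
  An invariant at \<open>s = 1\<close> depends on \<open>t\<close> only through \<open>\<Sum>i. t i *s h i\<close>, so it is a function on \<open>V\<close>.
\<close>

definition to_fun :: "'m rvar cpoly \<Rightarrow> complex ^ 'r \<Rightarrow> complex"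
  where "to_fun p x = cpoly_eval (rpoint (\<lambda>i. 1) (\<lambda>i. lform (coord i) x)) p"

lemma linear_to_fun: "Vector_Spaces.linear cpoly_scale fun_scale to_fun"
  by unfold_locales
    (auto simp: to_fun_def fun_eq_iff fun_scale_def cpoly_scale_def cpoly_eval_add cpoly_eval_mult)

lemma to_fun_eq:
  assumes "p \<in> invariant_ring h" "(\<Sum>i\<in>UNIV. t i *s h i) = x"
  shows "cpoly_eval (rpoint (\<lambda>i. 1) t) p = to_fun p x"
proof -
  define c :: "complex ^ 'm" where "c = (\<chi> i. t i - lform (coord i) x)"
  have "(\<Sum>i\<in>UNIV. c $ i *s h i) = 0"
    using assms(2) sum_coord[of x]
    by (simp add: c_def vec.scale_left_diff_distrib sum_subtractf)
  then have "c \<in> relations_group h"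
    by (simp add: relations_group_def)
  then have "cpoly_eval (rpoint (\<lambda>i. 1) (\<lambda>i. lform (coord i) x + c $ i * 1)) p = to_fun p x"
    using assms(1)[unfolded invariant_ring_iff, rule_format, of c "\<lambda>i. 1" "\<lambda>i. lform (coord i) x"]
    by (simp add: to_fun_def)
  then show ?thesis by (simp add: c_def)
qed

lemma hpoly_to_fun:
  assumes "homogeneous (degree_of d a) p"
  shows "hpoly d (to_fun p)"
proof -
  have "hpoly d (\<lambda>x. Poly_Mapping.lookup p w *
      (\<Prod>i\<in>UNIV. lform (coord i) x ^ Poly_Mapping.lookup w (TVar i)))"
    if w: "w \<in> Poly_Mapping.keys p" for w
  proof -
    have "monom_degree w None = d"
      using assms w by (simp add: homogeneous_def degree_of_def)
    then have d: "(\<Sum>i\<in>UNIV. Poly_Mapping.lookup w (TVar i) * 1) = d"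
      by (simp add: monom_degree_None)
    have "hpoly 1 (lform m)" for m :: "complex ^ 'r"
      using hpoly.mult[OF hpoly.const, of m 1] by simp
    then show ?thesis
      unfolding d[symmetric] by (intro hpoly_scale hpoly_prod hpoly_power)
  qed
  then have "hpoly d (\<lambda>x. \<Sum>w\<in>Poly_Mapping.keys p. Poly_Mapping.lookup p w *
      (\<Prod>i\<in>UNIV. lform (coord i) x ^ Poly_Mapping.lookup w (TVar i)))"
    by (rule hpoly_sum)
  then show ?thesis
    unfolding to_fun_def[abs_def] cpoly_eval_def monom_eval_rpoint_1 .
qed

text \<open>A move along \<open>h i\<close> can be realised by changing the single coordinate
  \<open>t i\<close>, so the degree in \<open>c\<close> is at most the largest exponent of
  \<open>t i\<close>. In each monomial the exponents of \<open>s i\<close> and \<open>t i\<close>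
  add up to \<open>weight a i\<close>.\<close>

lemma deg_along_to_fun:
  assumes p: "p \<in> invariants d a"
  shows "deg_along U (to_fun p) (h i) (weight a i)"
  unfolding deg_along_def
proof
  fix x
  define m where "m w = (\<Prod>k\<in>UNIV. [:lform (coord k) x, of_bool (k = i):] ^ Poly_Mapping.lookup w (TVar k))"
    for w :: "'m rvar \<Rightarrow>\<^sub>0 nat"
  define P where "P = (\<Sum>w\<in>Poly_Mapping.keys p. smult (Poly_Mapping.lookup p w) (m w))"
  have "degree (m w) \<le> weight a i" if w: "w \<in> Poly_Mapping.keys p" for w
  proof -
    have "degree (m w) \<le> (\<Sum>k\<in>UNIV. degree ([:lform (coord k) x, of_bool (k = i):] ^ Poly_Mapping.lookup w (TVar k)))"
      unfolding m_def by (rule order.trans[OF degree_prod_sum_le]) (simp_all add: o_def)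
    also have "\<dots> \<le> (\<Sum>k\<in>UNIV. if k = i then Poly_Mapping.lookup w (TVar k) else 0)"
    proof (rule sum_mono)
      fix k
      show "degree ([:lform (coord k) x, of_bool (k = i):] ^ Poly_Mapping.lookup w (TVar k)) \<le>
          (if k = i then Poly_Mapping.lookup w (TVar k) else 0)"
        by (rule order.trans[OF degree_power_le]) auto
    qed
    also have "\<dots> \<le> monom_degree w (Some i)"
      by (simp add: monom_degree_Some)
    also have "\<dots> = weight a i"
      using p w by (simp add: invariants_def homogeneous_def degree_of_def)
    finally show ?thesis .
  qed
  then have "degree P \<le> weight a i"
    unfolding P_def by (intro degree_sum_le) (auto intro: order.trans[OF degree_smult_le])
  moreover have "to_fun p (x + c *s h i) = poly P c" for c
  proof -
    let ?t = "\<lambda>k. lform (coord k) x + c * of_bool (k = i)"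
    have "(\<Sum>k\<in>UNIV. (c * of_bool (k = i)) *s h k) = (\<Sum>k\<in>UNIV. if k = i then c *s h k else 0)"
      by (intro sum.cong) auto
    then have "(\<Sum>k\<in>UNIV. ?t k *s h k) = x + c *s h i"
      by (simp add: vec.scale_left_distrib sum.distrib sum_coord)
    then have "to_fun p (x + c *s h i) = cpoly_eval (rpoint (\<lambda>k. 1) ?t) p"
      using p by (intro to_fun_eq[symmetric]) (auto simp: invariants_def)
    also have "\<dots> = poly P c"
      by (simp add: P_def m_def cpoly_eval_def monom_eval_rpoint_1 poly_sum poly_prod poly_power)
    finally show ?thesis .
  qed
  ultimately show "\<exists>p'. degree p' \<le> weight a i \<and> (\<forall>c. to_fun p (x + c *s h i) = poly p' c)"
    by blast
qed

text \<open>In a fixed degree the exponents of the \<open>t i\<close> determine those of the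
  \<open>s i\<close>, so distinct monomials stay distinct at \<open>s = 1\<close>.\<close>

lemma to_fun_eq_0:
  assumes p: "p \<in> invariants d a" and 0: "to_fun p = 0"
  shows "p = 0"
proof -
  have "Poly_Mapping.lookup p w = 0" if w: "w \<in> Poly_Mapping.keys p" for w
  proof (rule monomials_independent[where c = "Poly_Mapping.lookup p" and e = "\<lambda>w i. Poly_Mapping.lookup w (TVar i)"])
    show "inj_on (\<lambda>w i. Poly_Mapping.lookup w (TVar i)) (Poly_Mapping.keys p)"
    proof (rule inj_onI)
      fix v w assume vw: "v \<in> Poly_Mapping.keys p" "w \<in> Poly_Mapping.keys p"
        and eq: "(\<lambda>i. Poly_Mapping.lookup v (TVar i)) = (\<lambda>i. Poly_Mapping.lookup w (TVar i))"
      have deg: "monom_degree v (Some i) = monom_degree w (Some i)" for i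
        using p vw by (simp add: invariants_def homogeneous_def)
      have "Poly_Mapping.lookup v (SVar i) = Poly_Mapping.lookup w (SVar i)" for i
        using deg[of i] fun_cong[OF eq, of i] by (simp add: monom_degree_Some)
      moreover have "Poly_Mapping.lookup v (TVar i) = Poly_Mapping.lookup w (TVar i)" for i
        using fun_cong[OF eq, of i] .
      ultimately have "Poly_Mapping.lookup v x = Poly_Mapping.lookup w x" for x
        by (cases x) auto
      then show "v = w" by (rule poly_mapping_eqI)
    qed
    show "(\<Sum>w\<in>Poly_Mapping.keys p. Poly_Mapping.lookup p w *
        (\<Prod>i\<in>UNIV. t i ^ Poly_Mapping.lookup w (TVar i))) = 0" for t
    proof -
      have "cpoly_eval (rpoint (\<lambda>i. 1) t) p = to_fun p (\<Sum>i\<in>UNIV. t i *s h i)"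
        using p by (intro to_fun_eq) (auto simp: invariants_def)
      then show ?thesis
        by (simp add: 0 cpoly_eval_def monom_eval_rpoint_1)
    qed
  qed (use w in auto)
  then have "Poly_Mapping.lookup p w = 0" for w
    by (cases "w \<in> Poly_Mapping.keys p") (auto simp: in_keys_iff)
  then show ?thesis
    by (intro poly_mapping_eqI) simp
qed

text \<open>This is \<open>l j\<close> applied to the sum of the vectors
  \<open>(t i / s i) *s h i\<close>, with denominators cleared by the product of the
  \<open>s k\<close> for which \<open>l j\<close> is nonzero on \<open>h k\<close>. It is invariant
  because the group shifts each ratio by the coefficient of a relation.\<close>

definition lform_lift :: "'n \<Rightarrow> 'm rvar cpoly"
  where "lform_lift j = (\<Sum>i | lform (l j) (h i) \<noteq> 0. cpoly_const (lform (l j) (h i)) *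
    (cpoly_var (TVar i) * (\<Prod>k\<in>{k. lform (l j) (h k) \<noteq> 0} - {i}. cpoly_var (SVar k))))"

lemma cpoly_eval_lform_lift:
  "cpoly_eval (rpoint s t) (lform_lift j) = (\<Sum>i | lform (l j) (h i) \<noteq> 0. lform (l j) (h i) *
    (t i * (\<Prod>k\<in>{k. lform (l j) (h k) \<noteq> 0} - {i}. s k)))"
  by (simp add: lform_lift_def cpoly_eval_sum cpoly_eval_mult cpoly_eval_prod)

lemma sum_lform_nonzero:
  "(\<Sum>i | lform (l j) (h i) \<noteq> 0. lform (l j) (h i) * c i) = lform (l j) (\<Sum>i\<in>UNIV. c i *s h i)"
proof -
  have "(\<Sum>i | lform (l j) (h i) \<noteq> 0. lform (l j) (h i) * c i) = (\<Sum>i\<in>UNIV. lform (l j) (h i) * c i)"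
    by (rule sum.mono_neutral_left) auto
  then show ?thesis
    by (simp add: lform_sum_right lform_scale_right mult.commute)
qed

lemma lform_lift_invariant: "lform_lift j \<in> invariant_ring h"
  unfolding invariant_ring_iff
proof (intro ballI allI)
  fix c :: "complex ^ 'm" and s t :: "'m \<Rightarrow> complex"
  assume c: "c \<in> relations_group h"
  let ?I = "{i. lform (l j) (h i) \<noteq> 0}"
  have split: "(\<Prod>k\<in>?I. s k) = s i * (\<Prod>k\<in>?I - {i}. s k)" if "i \<in> ?I" for i
    using that by (intro prod.remove) auto
  have "cpoly_eval (rpoint s (\<lambda>i. t i + c $ i * s i)) (lform_lift j) -
      cpoly_eval (rpoint s t) (lform_lift j) =
      (\<Sum>i\<in>?I. (lform (l j) (h i) * c $ i) * (s i * (\<Prod>k\<in>?I - {i}. s k)))"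
    unfolding cpoly_eval_lform_lift sum_subtractf[symmetric]
    by (intro sum.cong refl) (simp add: algebra_simps)
  also have "\<dots> = (\<Sum>i\<in>?I. (lform (l j) (h i) * c $ i) * (\<Prod>k\<in>?I. s k))"
    by (intro sum.cong refl) (simp only: split)
  also have "\<dots> = lform (l j) (\<Sum>i\<in>UNIV. c $ i *s h i) * (\<Prod>k\<in>?I. s k)"
    unfolding sum_distrib_right[symmetric] sum_lform_nonzero ..
  also have "\<dots> = 0"
    using c by (simp add: relations_group_def)
  finally show "cpoly_eval (rpoint s (\<lambda>i. t i + c $ i * s i)) (lform_lift j) =
      cpoly_eval (rpoint s t) (lform_lift j)" by simp
qed

lemma to_fun_lform_lift: "to_fun (lform_lift j) x = lform (l j) x"
  unfolding to_fun_def cpoly_eval_lform_lift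
  by (simp add: sum_lform_nonzero sum_coord)

lemma homogeneous_lform_lift:
  "homogeneous (case_option 1 (\<lambda>i. of_bool (lform (l j) (h i) \<noteq> 0))) (lform_lift j)"
  unfolding lform_lift_def
proof (rule homogeneous_sum)
  let ?I = "{i. lform (l j) (h i) \<noteq> 0}"
  fix i assume i: "i \<in> ?I"
  have "homogeneous (\<lambda>k. 0 + (var_degree (TVar i) k + (\<Sum>x\<in>?I - {i}. var_degree (SVar x) k)))
      (cpoly_const (lform (l j) (h i)) * (cpoly_var (TVar i) * (\<Prod>k\<in>?I - {i}. cpoly_var (SVar k))))"
    by (intro homogeneous_mult homogeneous_const homogeneous_var homogeneous_prod)
  moreover have "0 + (var_degree (TVar i) k + (\<Sum>x\<in>?I - {i}. var_degree (SVar x) k)) =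
      case_option 1 (\<lambda>i. of_bool (lform (l j) (h i) \<noteq> 0)) k" for k
    using i by (cases k) (auto simp: of_bool_def)
  ultimately show "homogeneous (case_option 1 (\<lambda>i. of_bool (lform (l j) (h i) \<noteq> 0)))
      (cpoly_const (lform (l j) (h i)) * (cpoly_var (TVar i) * (\<Prod>k\<in>?I - {i}. cpoly_var (SVar k))))"
    by (rule homogeneous_cong)
qed

lemma lprod_lift: "lprod d a f \<Longrightarrow> \<exists>p\<in>invariants d a. to_fun p = f"
proof (induction rule: lprod.induct)
  case (zero d a)
  show ?case
    by (intro bexI[of _ 0] invariants_zero) (simp add: to_fun_def fun_eq_iff)
next
  case (const a c)
  \<comment> \<open>The powers of the \<open>s i\<close> fill the degree up to
    \<open>weight a\<close> and disappear at \<open>s = 1\<close>.\<close>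
  let ?p = "cpoly_const c * (\<Prod>i\<in>UNIV. cpoly_var (SVar i) ^ weight a i)"
  have "homogeneous (\<lambda>k. 0 + (\<Sum>i\<in>UNIV. weight a i * var_degree (SVar i) k)) ?p"
    by (intro homogeneous_mult homogeneous_const homogeneous_prod homogeneous_power homogeneous_var)
  moreover have "0 + (\<Sum>i\<in>UNIV. weight a i * var_degree (SVar i) k) = degree_of 0 a k" for k
    by (cases k) (simp_all add: degree_of_def of_bool_def if_distrib cong: if_cong)
  ultimately have "homogeneous (degree_of 0 a) ?p"
    by (rule homogeneous_cong)
  moreover have "?p \<in> invariant_ring h"
    by (simp add: invariant_ring_iff cpoly_eval_mult cpoly_eval_prod cpoly_eval_power)
  moreover have "to_fun ?p = (\<lambda>x. c)"
    by (simp add: to_fun_def fun_eq_iff cpoly_eval_mult cpoly_eval_prod cpoly_eval_power)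
  ultimately show ?case
    unfolding invariants_def by blast
next
  case (mult d a f j)
  then obtain p where p: "p \<in> invariants d a" "to_fun p = f" by blast
  have "homogeneous (\<lambda>k. case_option 1 (\<lambda>i. of_bool (lform (l j) (h i) \<noteq> 0)) k + degree_of d a k)
      (lform_lift j * p)"
    using p(1) by (intro homogeneous_mult homogeneous_lform_lift) (simp add: invariants_def)
  moreover have "case_option 1 (\<lambda>i. of_bool (lform (l j) (h i) \<noteq> 0)) k + degree_of d a k =
      degree_of (Suc d) (a(j := Suc (a j))) k" for k
    by (cases k) (simp_all add: degree_of_def weight_upd_Suc del: fun_upd_apply)
  ultimately have "homogeneous (degree_of (Suc d) (a(j := Suc (a j)))) (lform_lift j * p)"
    by (rule homogeneous_cong)
  moreover have "lform_lift j * p \<in> invariant_ring h"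
    using p(1) lform_lift_invariant[of j]
    by (simp add: invariants_def invariant_ring_iff cpoly_eval_mult)
  moreover have "to_fun (lform_lift j * p) = (\<lambda>x. lform (l j) x * f x)"
    using p(2) to_fun_lform_lift by (auto simp: to_fun_def cpoly_eval_mult fun_eq_iff)
  ultimately show ?case
    unfolding invariants_def by blast
next
  case (add d a f g)
  then obtain p q where "p \<in> invariants d a" "to_fun p = f" "q \<in> invariants d a" "to_fun q = g"
    by blast
  then show ?case
    by (intro bexI[of _ "p + q"] invariants_add) (auto simp: to_fun_def cpoly_eval_add fun_eq_iff)
qed

lemma to_fun_invariants: "to_fun ` invariants d a = cspace {} d a"
proof -
  have restr: "restr {} f = f" for f
    by (simp add: restr_def flat_def)
  show ?thesis
  proof
    have "admissible {} d a (to_fun p)" if "p \<in> invariants d a" for p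
      using that hpoly_to_fun deg_along_to_fun by (auto simp: admissible_def invariants_def)
    then show "to_fun ` invariants d a \<subseteq> cspace {} d a"
      by (auto simp: cspace_def restr)
    show "cspace {} d a \<subseteq> to_fun ` invariants d a"
    proof
      fix f assume "f \<in> cspace {} d a"
      then have "admissible {} d a f"
        by (auto simp: cspace_def restr)
      then obtain p where "lprod d a p" "\<forall>x\<in>flat {}. f x = p x"
        using admissible_eq_lprod by blast
      then have "lprod d a f"
        by (simp add: flat_def flip: fun_eq_iff)
      then show "f \<in> to_fun ` invariants d a"
        using lprod_lift by blast
    qed
  qed
qed

lemma dim_invariants:
  assumes "fn.has_dim (cspace {} d a) n"
  shows "cpoly.dim (invariants d a) = n"
proof -
  have "to_fun 0 = 0"
    by (simp add: to_fun_def fun_eq_iff)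
  then have "{p \<in> invariants d a. to_fun p = 0} = {0}"
    using to_fun_eq_0 invariants_zero by blast
  then have "cpoly.has_dim {p \<in> invariants d a. to_fun p = 0} 0"
    using cpoly.has_dim_0 by simp
  then have "cpoly.has_dim (invariants d a) (0 + n)"
    using assms by (intro cpoly_fn.has_dim_kernel_image[OF linear_to_fun subspace_invariants])
      (simp_all add: to_fun_invariants)
  then show ?thesis
    by (simp add: cpoly.dim_eq_has_dim)
qed

end

section \<open>Summation\<close>

text \<open>After exchanging the sums over \<open>a\<close> and \<open>E\<close> the summand factors
  over the coordinates, so the sum over a box is a product of truncated geometric series.\<close>

lemma (in lines_arrangement) sum_rank_gen:
  fixes t q :: "'a::comm_ring_1" and S :: "'n \<Rightarrow> 'a"
  shows "(\<Sum>a\<in>PiE UNIV (\<lambda>_. {..<K}). rank_gen t q {} a * (\<Prod>j\<in>UNIV. S j ^ a j)) =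
    (\<Sum>E\<in>UNIV. q ^ rank E *
      (\<Prod>j\<in>UNIV. if j \<in> E then (\<Sum>k<K. S j ^ k) - (\<Sum>k<K. (S j * t) ^ k) else (\<Sum>k<K. (S j * t) ^ k)))"
proof -
  define g where "g E j k = (if j \<in> E then S j ^ k - (S j * t) ^ k else (S j * t) ^ k)" for E j k
  have prod_g: "((\<Prod>e\<in>E. 1 - t ^ a e) * (\<Prod>e\<in>- E. t ^ a e)) * (\<Prod>j\<in>UNIV. S j ^ a j) =
      (\<Prod>j\<in>UNIV. g E j (a j))" for E and a :: "'n \<Rightarrow> nat"
  proof -
    have "(\<Prod>e\<in>E. 1 - t ^ a e) * (\<Prod>e\<in>- E. t ^ a e) = (\<Prod>j\<in>UNIV. if j \<in> E then 1 - t ^ a j else t ^ a j)"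
      by (simp add: prod.If_cases Collect_neg_eq)
    then show ?thesis
      by (simp add: prod.distrib[symmetric] g_def)
        (auto intro!: prod.cong simp: algebra_simps power_mult_distrib)
  qed
  have "rank {} = 0"
    by (simp add: rank_def)
  then have "(\<Sum>a\<in>PiE UNIV (\<lambda>_. {..<K}). rank_gen t q {} a * (\<Prod>j\<in>UNIV. S j ^ a j)) =
      (\<Sum>a\<in>PiE UNIV (\<lambda>_. {..<K}). \<Sum>E\<in>UNIV. q ^ rank E * (\<Prod>j\<in>UNIV. g E j (a j)))"
    by (simp add: rank_gen_def sum_distrib_right prod_g[symmetric] mult.assoc)
  also have "\<dots> = (\<Sum>E\<in>UNIV. q ^ rank E * (\<Sum>a\<in>PiE UNIV (\<lambda>_. {..<K}). \<Prod>j\<in>UNIV. g E j (a j)))"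
    unfolding sum_distrib_left by (rule sum.swap)
  also have "\<dots> = (\<Sum>E\<in>UNIV. q ^ rank E * (\<Prod>j\<in>UNIV. \<Sum>k<K. g E j k))"
    by (subst prod_sum_PiE) auto
  also have "\<dots> = (\<Sum>E\<in>UNIV. q ^ rank E * (\<Prod>j\<in>UNIV. if j \<in> E
      then (\<Sum>k<K. S j ^ k) - (\<Sum>k<K. (S j * t) ^ k) else (\<Sum>k<K. (S j * t) ^ k)))"
    by (intro sum.cong refl arg_cong2[of _ _ _ _ "(*)"] prod.cong) (auto simp: g_def sum_subtractf)
  finally show ?thesis .
qed

lemma mfps_X_nth_0 [simp]: "mfps_nth (mfps_X v :: ('v, 'a::comm_ring_1) mfps) 0 = 0"
proof -
  have "Poly_Mapping.single v (1::nat) \<noteq> 0"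
    by (metis lookup_single_eq lookup_zero zero_neq_one)
  then show ?thesis
    by (simp add: mfps_X_def)
qed

lemma mfps_nth_prod_0:
  fixes f :: "'i \<Rightarrow> ('v, 'a::comm_ring_1) mfps"
  shows "mfps_nth (prod f A) 0 = (\<Prod>x\<in>A. mfps_nth (f x) 0)"
  by (induction A rule: infinite_finite_induct) (auto simp: mfps_nth_mult_0)

lemma agree_mult_0:
  fixes f g :: "('v, 'a::comm_ring_1) mfps"
  assumes "agree N f 0"
  shows "agree N (f * g) 0"
  using agree_mult[OF assms agree_refl[of N g]] by simp

lemma agree_power_ge_0:
  fixes f :: "('v, 'a::comm_ring_1) mfps"
  assumes "mfps_nth f 0 = 0" "N \<le> k"
  shows "agree N (f ^ k) 0"
  using agree_mono[OF agree_power_0[OF assms(1)] assms(2)] .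

lemma arr_line_eq_span:
  assumes "K \<in> arr_lines l" "v \<in> K" "v \<noteq> 0"
  shows "K = vec.span {v}"
proof -
  obtain J where J: "K = (\<Inter>j\<in>J. hyperplane_of (l j))" and dim: "vec.dim K = 1"
    using assms(1) by (auto simp: arr_lines_def)
  have sub: "vec.subspace K"
    unfolding J by (auto simp: vec.subspace_def hyperplane_of_lform lform_add_right lform_scale_right)
  have "vec.span {v} = K"
  proof (rule vec.subspace_dim_equal[OF vec.subspace_span sub])
    show "vec.span {v} \<subseteq> K"
      using assms(2) sub by (intro vec.span_minimal) auto
    show "vec.dim K \<le> vec.dim (vec.span {v})"
      using assms(3) by (simp add: dim vec.dim_eq_card_independent)
  qed
  then show ?thesis by simp
qed

theorem theorem6p8:
  fixes l :: "'n::finite \<Rightarrow> complex ^ 'r"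
    and L :: "'m::finite \<Rightarrow> (complex ^ 'r) set"
    and h :: "'m \<Rightarrow> complex ^ 'r"
  assumes "arrangement l" and "essential l"
    and "bij_betw L UNIV (arr_lines l)"
    and "\<And>i. h i \<in> L i" and "\<And>i. h i \<noteq> 0"
  shows "zonotopal_cox_hilb l L h =
    1 / (\<Prod>j\<in>UNIV. 1 - hyperplane_monom l L j * hilb_t) *
    tutte_mv l (1 - hilb_t)
      (\<lambda>j. hyperplane_monom l L j * (1 - hilb_t) / (1 - hyperplane_monom l L j))"
proof -
  have L_line: "L i \<in> arr_lines l" for i
    using assms(3) by (auto simp: bij_betw_def)
  have L_span: "L i = vec.span {h i}" for i
    using arr_line_eq_span L_line assms(4,5) by blast
  interpret lines_arrangement l h
  proof
    show "essential l" by (rule assms(2))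
    fix K assume "K \<in> arr_lines l"
    then show "\<exists>i. K = vec.span {h i}"
      using assms(3) L_span by (metis bij_betw_def imageE)
  qed
  have L_sub: "L i \<subseteq> hyperplane_of (l j) \<longleftrightarrow> lform (l j) (h i) = 0" for i j
  proof
    assume "L i \<subseteq> hyperplane_of (l j)"
    then show "lform (l j) (h i) = 0"
      using assms(4) by (auto simp: hyperplane_of_lform)
  next
    assume "lform (l j) (h i) = 0"
    then show "L i \<subseteq> hyperplane_of (l j)"
      by (auto simp: L_span vec.span_singleton hyperplane_of_lform lform_scale_right)
  qed
  define S :: "'n \<Rightarrow> ('m option, int) mfps" where "S = hyperplane_monom l L"
  define t :: "('m option, int) mfps" where "t = hilb_t"
  define q where "q = inverse (1 - t)"
  define V where "V j = inverse (1 - S j * t)" for j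
  define W where "W j = inverse (1 - S j)" for j
  have S_eq: "S j = (\<Prod>i | lform (l j) (h i) \<noteq> 0. hilb_s i)" for j
    by (simp add: S_def hyperplane_monom_def L_sub)
  have t0: "mfps_nth t 0 = 0"
    by (simp add: t_def)
  \<comment> \<open>Some line lies off the hyperplane of \<open>l j\<close>, so \<open>S j\<close>
    is a nonempty product of variables; hence \<open>1 - S j\<close> is a unit.\<close>
  have S0: "mfps_nth (S j) 0 = 0" for j
  proof -
    obtain K where K: "K \<in> arr_lines l" "\<not> K \<subseteq> hyperplane_of (l j)"
      using line_not_subset_hyperplane[OF assms(2), of j] assms(1) by (auto simp: arrangement_def)
    then obtain i where "K = L i"
      using assms(3) by (metis bij_betw_def imageE)
    then have "lform (l j) (h i) \<noteq> 0"
      using K(2) L_sub by blast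
    then show ?thesis
      unfolding S_eq mfps_nth_prod_0 by (intro prod_zero) auto
  qed
  have q: "q * (1 - t) = 1"
    using mfps_is_unit[of "1 - t"] t0 by (simp add: q_def mult.commute)
  have V: "(1 - S j * t) * V j = 1" and W: "(1 - S j) * W j = 1" for j
    unfolding V_def W_def using S0[of j] by (auto intro!: mfps_is_unit simp: mfps_nth_mult_0)
  \<comment> \<open>The difference of the two geometric series is the Tutte weight times a factor of
    the prefactor, which can then be pulled out of every term.\<close>
  have WV: "W j - V j = V j * (S j * (1 - t) * W j)" for j
  proof -
    have "W j - V j = W j * ((1 - S j * t) * V j) - V j * ((1 - S j) * W j)"
      by (simp add: V W)
    also have "\<dots> = V j * (S j * (1 - t) * W j)"
      by (simp add: algebra_simps)
    finally show ?thesis .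
  qed

  have weight: "(incidence_matrix l L *v a) $ i = weight (($) a) i" for a i
    unfolding matrix_vector_mult_def weight_def incidence_matrix_def L_sub
    by (simp add: sum.inter_filter[symmetric] if_distrib[of "\<lambda>u. u * _"] cong: if_cong)
      (auto intro!: sum.mono_neutral_cong)
  have comp: "zonotopal_cox_component l L h d a = invariants d (($) a)" for d a
    unfolding zonotopal_cox_component_def invariant_component_def invariants_def homogeneous_def
      degree_of_def weight[abs_def] ..
  have monom: "(\<Prod>i\<in>UNIV. hilb_s i ^ weight a i) = (\<Prod>j\<in>UNIV. S j ^ a j)" for a
  proof -
    have "(\<Prod>i\<in>UNIV. hilb_s i ^ weight a i) =
        (\<Prod>i\<in>UNIV. \<Prod>j | j \<in> UNIV \<and> lform (l j) (h i) \<noteq> 0. hilb_s i ^ a j)"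
      by (simp add: weight_def power_sum)
    also have "\<dots> = (\<Prod>j\<in>UNIV. \<Prod>i | i \<in> UNIV \<and> lform (l j) (h i) \<noteq> 0. hilb_s i ^ a j)"
      by (rule prod.swap_restrict) auto
    finally show ?thesis
      by (simp add: S_eq prod_power_distrib)
  qed
  have "\<exists>N. \<forall>a. (\<forall>d. fn.has_dim (cspace {} d a) (N a d)) \<and>
      (\<forall>M \<ge> sum a UNIV. (\<Sum>d\<le>M. of_nat (N a d) * t ^ d) = rank_gen t q {} a)"
    by (intro choice allI cspace_hilbert_series q)
  then obtain N where N: "\<And>a d. fn.has_dim (cspace {} d a) (N a d)"
    "\<And>a M. M \<ge> sum a UNIV \<Longrightarrow> (\<Sum>d\<le>M. of_nat (N a d) * t ^ d) = rank_gen t q {} a"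
    by blast
  have hilb: "zonotopal_cox_hilb l L h =
      mfps_Sum (\<lambda>(d, a). of_nat (N (($) a) d) * t ^ d * (\<Prod>j\<in>UNIV. S j ^ a $ j))"
    unfolding zonotopal_cox_hilb_def comp weight monom dim_invariants[OF N(1)] t_def ..
  \<comment> \<open>The limit of the box sums in \<open>sum_rank_gen\<close>, with the truncated
    geometric series replaced by \<open>W j\<close> and \<open>V j\<close>.\<close>
  define R where "R = (\<Sum>E\<in>UNIV. q ^ rank E * (\<Prod>j\<in>UNIV. if j \<in> E then W j - V j else V j))"

  have "zonotopal_cox_hilb l L h = R"
  proof (rule mfps_eqI)
    fix w :: "'m option \<Rightarrow>\<^sub>0 nat"
    \<comment> \<open>Terms with \<open>d \<ge> K\<close> or some \<open>a $ j \<ge> K\<close> have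
      order at least \<open>K\<close> and cannot reach the exponent \<open>w\<close>.\<close>
    define K where "K = Suc (total_degree w)"
    \<comment> \<open>Bounds the sum of every \<open>a\<close> in the box, so the partial sums over
      \<open>d\<close> are complete; it is at least \<open>K\<close> since the index type is
      nonempty.\<close>
    define M where "M = CARD('n) * K"
    define A where "A = {a :: nat ^ 'n. \<forall>j. a $ j < K}"
    define F where "F d a = of_nat (N (($) a) d) * t ^ d * (\<Prod>j\<in>UNIV. S j ^ a $ j)" for d and a :: "nat ^ 'n"
    have bij: "bij_betw ($) A (PiE UNIV (\<lambda>_. {..<K}))"
      by (rule bij_betw_byWitness[where f' = vec_lambda]) (auto simp: A_def)
    have "finite (PiE UNIV (\<lambda>_ :: 'n. {..<K}))"
      by (intro finite_PiE) auto
    then have fin: "finite A"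
      using bij bij_betw_finite by blast
    have zero: "mfps_nth (F d a) w = 0" if "(d, a) \<notin> {..M} \<times> A" for d a
    proof -
      have "agree K (F d a) 0"
      proof (cases "a \<in> A")
        case True
        then have "K \<le> d"
          using that by (simp add: M_def) (metis One_nat_def Suc_leI le_trans less_imp_le
              mult_le_mono1 nat_mult_1 not_le zero_less_card_finite)
        then have "agree K (t ^ d * (of_nat (N (($) a) d) * (\<Prod>j\<in>UNIV. S j ^ a $ j))) 0"
          by (intro agree_mult_0 agree_power_ge_0 t0)
        then show ?thesis by (simp add: F_def mult_ac)
      next
        case False
        then obtain j where "K \<le> a $ j"
          by (auto simp: A_def not_less)
        then have "agree K (S j ^ a $ j * ((\<Prod>j\<in>UNIV - {j}. S j ^ a $ j) * (of_nat (N (($) a) d) * t ^ d))) 0"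
          by (intro agree_mult_0 agree_power_ge_0 S0)
        moreover have "(\<Prod>j\<in>UNIV. S j ^ a $ j) = S j ^ a $ j * (\<Prod>j\<in>UNIV - {j}. S j ^ a $ j)"
          by (rule prod.remove) auto
        ultimately show ?thesis by (simp add: F_def mult_ac)
      qed
      then show ?thesis by (simp add: agree_def K_def)
    qed
    have "mfps_nth (zonotopal_cox_hilb l L h) w = Sum_any (\<lambda>x. mfps_nth (case x of (d, a) \<Rightarrow> F d a) w)"
      by (simp add: hilb mfps_Sum_def F_def)
    also have "\<dots> = (\<Sum>x\<in>{..M} \<times> A. mfps_nth (case x of (d, a) \<Rightarrow> F d a) w)"
      using zero fin by (intro Sum_any.expand_superset) auto
    also have "\<dots> = mfps_nth (\<Sum>a\<in>A. \<Sum>d\<le>M. F d a) w"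
      unfolding mfps_nth_sum by (subst sum.swap) (simp add: sum.cartesian_product case_prod_beta)
    also have "(\<Sum>a\<in>A. \<Sum>d\<le>M. F d a) = (\<Sum>a\<in>A. rank_gen t q {} (($) a) * (\<Prod>j\<in>UNIV. S j ^ a $ j))"
    proof (rule sum.cong[OF refl])
      fix a assume a: "a \<in> A"
      have "sum (($) a) UNIV \<le> (\<Sum>j\<in>(UNIV :: 'n set). K)"
        using a by (intro sum_mono) (auto simp: A_def less_imp_le)
      then have "sum (($) a) UNIV \<le> M"
        by (simp add: M_def)
      from N(2)[OF this] show "(\<Sum>d\<le>M. F d a) = rank_gen t q {} (($) a) * (\<Prod>j\<in>UNIV. S j ^ a $ j)"
        by (simp add: F_def sum_distrib_right[symmetric])
    qed
    also have "\<dots> = (\<Sum>a\<in>PiE UNIV (\<lambda>_. {..<K}). rank_gen t q {} a * (\<Prod>j\<in>UNIV. S j ^ a j))"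
      by (rule sum.reindex_bij_betw[OF bij])
    also have "mfps_nth \<dots> w = mfps_nth R w"
    proof -
      have V_agree: "agree K (\<Sum>k<K. (S j * t) ^ k) (V j)" for j
        unfolding V_def by (rule agree_geometric) (simp add: mfps_nth_mult_0 S0)
      have W_agree: "agree K (\<Sum>k<K. S j ^ k) (W j)" for j
        unfolding W_def by (rule agree_geometric) (rule S0)
      have "agree K (\<Sum>a\<in>PiE UNIV (\<lambda>_. {..<K}). rank_gen t q {} a * (\<Prod>j\<in>UNIV. S j ^ a j)) R"
        unfolding sum_rank_gen R_def
        by (intro agree_sum agree_mult agree_prod agree_refl)
          (simp add: agree_diff V_agree W_agree)
      then show ?thesis by (simp add: agree_def K_def)
    qed
    finally show "mfps_nth (zonotopal_cox_hilb l L h) w = mfps_nth R w" .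
  qed
  also have "R = (\<Prod>j\<in>UNIV. V j) * (\<Sum>E\<in>UNIV. q ^ rank E * (\<Prod>j\<in>E. S j * (1 - t) * W j))"
    unfolding R_def sum_distrib_left
  proof (rule sum.cong[OF refl])
    fix E
    have "(\<Prod>j\<in>UNIV. if j \<in> E then W j - V j else V j) =
        (\<Prod>j\<in>UNIV. V j * (if j \<in> E then S j * (1 - t) * W j else 1))"
      by (intro prod.cong) (auto simp: WV)
    also have "\<dots> = (\<Prod>j\<in>UNIV. V j) * (\<Prod>j\<in>E. S j * (1 - t) * W j)"
      by (subst prod.distrib) (simp add: prod.If_cases)
    finally show "q ^ rank E * (\<Prod>j\<in>UNIV. if j \<in> E then W j - V j else V j) =
        (\<Prod>j\<in>UNIV. V j) * (q ^ rank E * (\<Prod>j\<in>E. S j * (1 - t) * W j))"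
      by (simp add: mult_ac)
  qed
  also have "(\<Prod>j\<in>UNIV. V j) = 1 / (\<Prod>j\<in>UNIV. 1 - S j * t)"
  proof -
    have "(\<Prod>j\<in>UNIV. 1 - S j * t) * (\<Prod>j\<in>UNIV. V j) = 1"
      by (simp add: prod.distrib[symmetric] V)
    then show ?thesis
      by (simp add: divide_mfps_def mfps_inverse_unique)
  qed
  also have "(\<Sum>E\<in>UNIV. q ^ rank E * (\<Prod>j\<in>E. S j * (1 - t) * W j)) =
      tutte_mv l (1 - t) (\<lambda>j. S j * (1 - t) / (1 - S j))"
    by (simp add: tutte_mv_def rank_def q_def W_def divide_mfps_def)
  finally show ?thesis
    by (simp only: S_def t_def)
qed

end
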